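(* Let $a<b$, $\alpha,\beta\in(0,1)$, $l\in\mathbb{R}$, and let $L,g:[a,b]\times\mathbb{R}^3\to\mathbb{R}$, $(x,y,u,v)\mapsto L(x,y,u,v)$, $(x,y,u,v)\mapsto g(x,y,u,v)$, have continuous first and second partial derivatives with respect to all their arguments. Put $$\mathcal{J}(y)=\int_a^b L\big(x,y(x),{_a\mathcal{D}_x^\alpha}y(x),{_x\mathcal{D}_b^\beta}y(x)\big)\,dx,\qquad \mathcal{I}(y)=\int_a^b g\big(x,y(x),{_a\mathcal{D}_x^\alpha}y(x),{_x\mathcal{D}_b^\beta}y(x)\big)\,dx$$ for admissible functions $y$. Suppose that $\mathcal{J}$ has a local minimum or a local maximum at the admissible function $y$ subject to the boundary conditions $y(a)=y_a$, $y(b)=y_b$ and the isoperimetric constraint $\mathcal{I}(y)=l$, and that $L$, $g$ satisfy along $y$ the regularity conditions listed in the context. Suppose further that $y$ is not an extremal for $\mathcal{I}$. Then there exists a constant $\lambda\in\mathbb{R}$ such that, with $F=L-\lambda g$, $$\frac{\partial F}{\partial y}+{_x\mathcal{D}_b^\alpha}\frac{\partial F}{\partial u}+{_a\mathcal{D}_x^\beta}\frac{\partial F}{\partial v}=0\quad\text{for all }x\in[a,b],$$ where the partial derivatives of $F$ are evaluated at $\big(x,y(x),{_a\mathcal{D}_x^\alpha}y(x),{_x\mathcal{D}_b^\beta}y(x)\big)$.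
   Context: For $\gamma\in(0,1)$, real numbers $c<d$ and a continuous function $f$, the left and right Riemann-Liouville fractional derivatives are $${_c\mathcal{D}_x^\gamma}f(x)=\frac{1}{\Gamma(1-\gamma)}\frac{d}{dx}\int_c^x (x-t)^{-\gamma}f(t)\,dt\quad (x>c),\qquad {_x\mathcal{D}_d^\gamma}f(x)=\frac{-1}{\Gamma(1-\gamma)}\frac{d}{dx}\int_x^d (t-x)^{-\gamma}f(t)\,dt\quad (x<d).$$ Saying that such a derivative is continuous on a closed interval means that it exists and extends continuously to the endpoint where the formula is not defined; values at that endpoint are the limits. Admissible functions: continuous $y:[a,b]\to\mathbb{R}$ such that ${_a\mathcal{D}_x^\alpha}y$ and ${_x\mathcal{D}_b^\beta}y$ are continuous on $[a,b]$. Each of these two requirements is imposed only if the corresponding derivative is present in the problem (i.e. $L$ or $g$ depends on $u$, respectively on $v$); if a derivative is not present, the corresponding argument is simply omitted. The prescribed boundary values satisfy $y_a=0$ if left fractional derivatives are present and $y_b=0$ if right fractional derivatives are present. Regularity conditions along $y$: the functions $x\mapsto\frac{\partial L}{\partial u}$ and $x\mapsto\frac{\partial g}{\partial u}$, evaluated at $(x,y(x),{_a\mathcal{D}_x^\alpha}y(x),{_x\mathcal{D}_b^\beta}y(x))$, have continuous right fractional derivative ${_x\mathcal{D}_b^\alpha}$ on $[a,b]$, and $x\mapsto\frac{\partial L}{\partial v}$, $x\mapsto\frac{\partial g}{\partial v}$, evaluated at the same point, have continuous left fractional derivative ${_a\mathcal{D}_x^\beta}$ on $[a,b]$. Local extremum: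 fix a norm $\|\cdot\|$ on the linear space of admissible functions. $\mathcal{J}$ has a local minimum (resp. maximum) at $y$ subject to the boundary conditions and the constraint if $y$ is admissible and satisfies them, and there is $\delta>0$ such that $\mathcal{J}(y)\le\mathcal{J}(y_1)$ (resp. $\mathcal{J}(y)\ge\mathcal{J}(y_1)$) for all admissible $y_1$ satisfying the same boundary conditions and constraint with $\|y-y_1\|<\delta$. Extremal: $y$ is an extremal for $\mathcal{I}$ if $\frac{\partial g}{\partial y}+{_x\mathcal{D}_b^\alpha}\frac{\partial g}{\partial u}+{_a\mathcal{D}_x^\beta}\frac{\partial g}{\partial v}=0$ for all $x\in[a,b]$, with the partial derivatives of $g$ evaluated along $y$. *)

theory Defs
  imports "HOL-Analysis.Analysis"
begin

text \<open>Functions on \<open>[a,b]\<close> are represented by total functions of which only the values on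
  \<open>{a..b}\<close> are ever used; accordingly all derivatives are taken within the domain, hence are
  one-sided at its boundary.\<close>

definition frac_conv_left :: "real \<Rightarrow> real \<Rightarrow> (real \<Rightarrow> real) \<Rightarrow> real \<Rightarrow> real" where
  "frac_conv_left c \<gamma> f x = integral {c..x} (\<lambda>t. (x - t) powr (- \<gamma>) * f t)"

definition frac_conv_right :: "real \<Rightarrow> real \<Rightarrow> (real \<Rightarrow> real) \<Rightarrow> real \<Rightarrow> real" where
  "frac_conv_right d \<gamma> f x = integral {x..d} (\<lambda>t. (t - x) powr (- \<gamma>) * f t)"

text \<open>Riemann-Liouville derivatives of order \<open>\<gamma>\<close> of a function on \<open>[c,d]\<close>. At the endpoint where
  the formula is not defined (\<open>c\<close> for the left, \<open>d\<close> for the right derivative) the value is the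
  limit.\<close>

definition RL_left :: "real \<Rightarrow> real \<Rightarrow> real \<Rightarrow> (real \<Rightarrow> real) \<Rightarrow> real \<Rightarrow> real" where
  "RL_left c d \<gamma> f x =
    (let D = (\<lambda>s. 1 / Gamma (1 - \<gamma>) *
                vector_derivative (frac_conv_left c \<gamma> f) (at s within {c..d}))
     in if x = c then Lim (at_right c) D else D x)"

definition RL_right :: "real \<Rightarrow> real \<Rightarrow> real \<Rightarrow> (real \<Rightarrow> real) \<Rightarrow> real \<Rightarrow> real" where
  "RL_right c d \<gamma> f x =
    (let D = (\<lambda>s. - 1 / Gamma (1 - \<gamma>) *
                vector_derivative (frac_conv_right d \<gamma> f) (at s within {c..d}))
     in if x = d then Lim (at_left d) D else D x)"

definition has_cont_RL_left :: "real \<Rightarrow> real \<Rightarrow> real \<Rightarrow> (real \<Rightarrow> real) \<Rightarrow> bool" where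
  "has_cont_RL_left c d \<gamma> f \<longleftrightarrow>
    (\<forall>x\<in>{c<..d}. frac_conv_left c \<gamma> f differentiable (at x within {c..d})) \<and>
    continuous_on {c..d} (RL_left c d \<gamma> f)"

definition has_cont_RL_right :: "real \<Rightarrow> real \<Rightarrow> real \<Rightarrow> (real \<Rightarrow> real) \<Rightarrow> bool" where
  "has_cont_RL_right c d \<gamma> f \<longleftrightarrow>
    (\<forall>x\<in>{c..<d}. frac_conv_right d \<gamma> f differentiable (at x within {c..d})) \<and>
    continuous_on {c..d} (RL_right c d \<gamma> f)"

definition partial_deriv ::
  "'a::euclidean_space set \<Rightarrow> 'a \<Rightarrow> ('a \<Rightarrow> real) \<Rightarrow> 'a \<Rightarrow> real" where
  "partial_deriv S e f p =
    vector_derivative (\<lambda>t. f (p + t *\<^sub>R e)) (at 0 within {t. p + t *\<^sub>R e \<in> S})"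

definition C1_partials :: "'a::euclidean_space set \<Rightarrow> ('a \<Rightarrow> real) \<Rightarrow> bool" where
  "C1_partials S f \<longleftrightarrow>
    (\<forall>e\<in>Basis.
      (\<forall>p\<in>S. (\<lambda>t. f (p + t *\<^sub>R e)) differentiable (at 0 within {t. p + t *\<^sub>R e \<in> S})) \<and>
      continuous_on S (partial_deriv S e f))"

definition C2_partials :: "'a::euclidean_space set \<Rightarrow> ('a \<Rightarrow> real) \<Rightarrow> bool" where
  "C2_partials S f \<longleftrightarrow>
    C1_partials S f \<and> (\<forall>e\<in>Basis. C1_partials S (partial_deriv S e f))"

text \<open>A point is \<open>(x, y, u, v)\<close>, with \<open>u\<close> the slot of the left derivative of order \<open>\<alpha>\<close> and \<open>v\<close> that
  of the right derivative of order \<open>\<beta>\<close>.\<close>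

type_synonym pt = "real \<times> real \<times> real \<times> real"

definition dom4 :: "real \<Rightarrow> real \<Rightarrow> pt set" where
  "dom4 a b = {a..b} \<times> UNIV"

definition dir_y :: pt where "dir_y = (0, 1, 0, 0)"
definition dir_u :: pt where "dir_u = (0, 0, 1, 0)"
definition dir_v :: pt where "dir_v = (0, 0, 0, 1)"

definition depends_on :: "pt set \<Rightarrow> pt \<Rightarrow> (pt \<Rightarrow> real) \<Rightarrow> bool" where
  "depends_on S e f \<longleftrightarrow> (\<exists>p\<in>S. \<exists>t. p + t *\<^sub>R e \<in> S \<and> f (p + t *\<^sub>R e) \<noteq> f p)"

definition left_present :: "real \<Rightarrow> real \<Rightarrow> (pt \<Rightarrow> real) \<Rightarrow> (pt \<Rightarrow> real) \<Rightarrow> bool" where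
  "left_present a b L g \<longleftrightarrow> depends_on (dom4 a b) dir_u L \<or> depends_on (dom4 a b) dir_u g"

definition right_present :: "real \<Rightarrow> real \<Rightarrow> (pt \<Rightarrow> real) \<Rightarrow> (pt \<Rightarrow> real) \<Rightarrow> bool" where
  "right_present a b L g \<longleftrightarrow> depends_on (dom4 a b) dir_v L \<or> depends_on (dom4 a b) dir_v g"

text \<open>If a derivative is not present, then it may fail to exist and the corresponding component is
  an unspecified number; it is only ever fed to functions that do not depend on that component.\<close>

definition along ::
  "real \<Rightarrow> real \<Rightarrow> real \<Rightarrow> real \<Rightarrow> (real \<Rightarrow> real) \<Rightarrow> real \<Rightarrow> pt" where
  "along a b \<alpha> \<beta> y x = (x, y x, RL_left a b \<alpha> y x, RL_right a b \<beta> y x)"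

definition functional ::
  "real \<Rightarrow> real \<Rightarrow> real \<Rightarrow> real \<Rightarrow> (pt \<Rightarrow> real) \<Rightarrow> (real \<Rightarrow> real) \<Rightarrow> real" where
  "functional a b \<alpha> \<beta> L y = integral {a..b} (\<lambda>x. L (along a b \<alpha> \<beta> y x))"

definition admissible ::
  "real \<Rightarrow> real \<Rightarrow> real \<Rightarrow> real \<Rightarrow> (pt \<Rightarrow> real) \<Rightarrow> (pt \<Rightarrow> real) \<Rightarrow> (real \<Rightarrow> real) set" where
  "admissible a b \<alpha> \<beta> L g =
    {y. continuous_on {a..b} y \<and>
        (left_present a b L g \<longrightarrow> has_cont_RL_left a b \<alpha> y) \<and>
        (right_present a b L g \<longrightarrow> has_cont_RL_right a b \<beta> y)}"

definition regular_along ::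
  "real \<Rightarrow> real \<Rightarrow> real \<Rightarrow> real \<Rightarrow> (pt \<Rightarrow> real) \<Rightarrow> (real \<Rightarrow> real) \<Rightarrow> bool" where
  "regular_along a b \<alpha> \<beta> f y \<longleftrightarrow>
    has_cont_RL_right a b \<alpha> (\<lambda>x. partial_deriv (dom4 a b) dir_u f (along a b \<alpha> \<beta> y x)) \<and>
    has_cont_RL_left a b \<beta> (\<lambda>x. partial_deriv (dom4 a b) dir_v f (along a b \<alpha> \<beta> y x))"

definition euler_lagrange ::
  "real \<Rightarrow> real \<Rightarrow> real \<Rightarrow> real \<Rightarrow> (pt \<Rightarrow> real) \<Rightarrow> (real \<Rightarrow> real) \<Rightarrow> real \<Rightarrow> real" where
  "euler_lagrange a b \<alpha> \<beta> f y x =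
    partial_deriv (dom4 a b) dir_y f (along a b \<alpha> \<beta> y x)
    + RL_right a b \<alpha> (\<lambda>s. partial_deriv (dom4 a b) dir_u f (along a b \<alpha> \<beta> y s)) x
    + RL_left a b \<beta> (\<lambda>s. partial_deriv (dom4 a b) dir_v f (along a b \<alpha> \<beta> y s)) x"

definition extremal ::
  "real \<Rightarrow> real \<Rightarrow> real \<Rightarrow> real \<Rightarrow> (pt \<Rightarrow> real) \<Rightarrow> (real \<Rightarrow> real) \<Rightarrow> bool" where
  "extremal a b \<alpha> \<beta> f y \<longleftrightarrow> (\<forall>x\<in>{a..b}. euler_lagrange a b \<alpha> \<beta> f y x = 0)"

text \<open>A norm on a space \<open>V\<close> of functions on \<open>[a,b]\<close>. Representatives that agree on \<open>[a,b]\<close> are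
  identified, so \<open>N\<close> vanishes exactly on the functions that are zero on \<open>[a,b]\<close>.\<close>

definition norm_on :: "real \<Rightarrow> real \<Rightarrow> (real \<Rightarrow> real) set \<Rightarrow> ((real \<Rightarrow> real) \<Rightarrow> real) \<Rightarrow> bool" where
  "norm_on a b V N \<longleftrightarrow>
    (\<forall>f\<in>V. 0 \<le> N f \<and> (N f = 0 \<longleftrightarrow> (\<forall>x\<in>{a..b}. f x = 0))) \<and>
    (\<forall>f\<in>V. \<forall>r. N (\<lambda>x. r * f x) = \<bar>r\<bar> * N f) \<and>
    (\<forall>f\<in>V. \<forall>h\<in>V. N (\<lambda>x. f x + h x) \<le> N f + N h)"

definition local_min_at ::
  "(real \<Rightarrow> real) set \<Rightarrow> ((real \<Rightarrow> real) \<Rightarrow> real) \<Rightarrow> ((real \<Rightarrow> real) \<Rightarrow> real) \<Rightarrow> (real \<Rightarrow> real) \<Rightarrow> bool" where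
  "local_min_at K N J y \<longleftrightarrow>
    y \<in> K \<and> (\<exists>\<delta>>0. \<forall>y1\<in>K. N (\<lambda>x. y x - y1 x) < \<delta> \<longrightarrow> J y \<le> J y1)"

definition local_max_at ::
  "(real \<Rightarrow> real) set \<Rightarrow> ((real \<Rightarrow> real) \<Rightarrow> real) \<Rightarrow> ((real \<Rightarrow> real) \<Rightarrow> real) \<Rightarrow> (real \<Rightarrow> real) \<Rightarrow> bool" where
  "local_max_at K N J y \<longleftrightarrow>
    y \<in> K \<and> (\<exists>\<delta>>0. \<forall>y1\<in>K. N (\<lambda>x. y x - y1 x) < \<delta> \<longrightarrow> J y \<ge> J y1)"

definition isoperimetric_set ::
  "real \<Rightarrow> real \<Rightarrow> real \<Rightarrow> real \<Rightarrow> (pt \<Rightarrow> real) \<Rightarrow> (pt \<Rightarrow> real) \<Rightarrow> real \<Rightarrow> real \<Rightarrow> real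
    \<Rightarrow> (real \<Rightarrow> real) set" where
  "isoperimetric_set a b \<alpha> \<beta> L g ya yb l =
    {y \<in> admissible a b \<alpha> \<beta> L g. y a = ya \<and> y b = yb \<and> functional a b \<alpha> \<beta> g y = l}"

end

theory Submission
  imports Defs
begin

text \<open>Vary \<open>y\<close> by \<open>s\<^sub>1 \<eta>\<^sub>1 + s\<^sub>2 \<eta>\<^sub>2\<close>, where the \<open>\<eta>\<^sub>i\<close> are \<open>C\<^sup>1\<close> functions supported in \<open>[a,b]\<close>. The pair
  of functionals is then a continuous function of \<open>(s\<^sub>1, s\<^sub>2)\<close> that is differentiable at \<open>0\<close>. If
  its derivative there were invertible, the pair would attain all values near its value at \<open>0\<close>,
  against extremality under the constraint. Hence the first variations of the two functionals are
  proportional. Integration by parts for Riemann-Liouville derivatives expresses them through the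
  Euler-Lagrange expressions of \<open>L\<close> and \<open>g\<close>; as \<open>y\<close> is not an extremal, some \<open>\<eta>\<^sub>2\<close> has a nonzero first
  variation of the constraint, its ratio of variations is \<open>\<lambda>\<close>, and the fundamental lemma concludes.\<close>

section \<open>Riemann-Liouville derivatives\<close>

text \<open>The kernel \<open>(x - t) powr (- \<gamma>)\<close> is unbounded at the diagonal and its
  singular point moves with \<open>x\<close>, so neither differentiation under the integral sign nor
  Fubini for continuous integrands applies directly. Test functions that vanish outside the interval
  repair the first: the fractional derivative of \<eta> becomes, up to a constant, the convolution
  of its ordinary derivative. Integration by parts is then Fubini, to move the kernel, followed by
  the classical formula, to move the derivative. The norm is arbitrary and need not be related to
  the functionals, so no continuity on the function space is available. Inside a two-parameter
  family, however, the norm of the perturbation is at most linear in the parameters, which keeps the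
  competitors close to \<open>y\<close>. That all nearby values are attained comes from Sussmann's
  open mapping theorem, which asks for continuity and for a derivative with right inverse at a
  single point.\<close>

text \<open>The substitution \<open>r = (x - t) powr (1 - \<gamma>)\<close> absorbs the kernel,
  since its derivative is \<open>- (1 - \<gamma>) * (x - t) powr (- \<gamma>)\<close>; what remains
  is continuous on a compact interval. This settles integrability at the singular end
  \<open>t = x\<close> as well.\<close>

lemma frac_conv_left_has_integral:
  fixes f :: "real \<Rightarrow> real"
  assumes "0 < \<gamma>" "\<gamma> < 1" "c \<le> x" "continuous_on {c..x} f"
  shows "((\<lambda>t. (x - t) powr (- \<gamma>) * f t) has_integral
    1 / (1 - \<gamma>) * integral {0..(x - c) powr (1 - \<gamma>)} (\<lambda>r. f (x - r powr (1 / (1 - \<gamma>))))) {c..x}"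
proof -
  let ?q = "1 - \<gamma>"
  let ?F = "\<lambda>r. f (x - r powr (1 / ?q))"
  have sub: "(\<lambda>t. (x - t) powr ?q) ` {c..x} \<subseteq> {0..(x - c) powr ?q}"
    using assms by (auto intro!: powr_mono2)
  have rt: "c \<le> x - r powr (1 / ?q)" if "0 \<le> r" "r \<le> (x - c) powr ?q" for r
  proof -
    have "r powr (1 / ?q) \<le> ((x - c) powr ?q) powr (1 / ?q)"
      using that assms by (intro powr_mono2) auto
    also have "\<dots> = x - c" using assms by (simp add: powr_powr)
    finally show ?thesis by simp
  qed
  have cont: "continuous_on {0..(x - c) powr ?q} ?F"
    by (rule continuous_on_compose2[OF assms(4)])
      (use assms rt in \<open>auto intro!: continuous_intros continuous_on_powr'\<close>)
  \<comment> \<open>The substitution has no finite slope at \<open>t = x\<close>, hence the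
    exceptional set \<open>{x}\<close>. It reverses orientation; the first integral on the right is
    over an empty or one-point interval.\<close>
  have "((\<lambda>t. (- ?q * (x - t) powr (- \<gamma>)) *\<^sub>R ?F ((x - t) powr ?q)) has_integral
      (integral {(x - c) powr ?q..(x - x) powr ?q} ?F - integral {(x - x) powr ?q..(x - c) powr ?q} ?F)) {c..x}"
  proof (rule has_integral_substitution_general[where s = "{x}", OF _ assms(3) sub cont])
    show "continuous_on {c..x} (\<lambda>t. (x - t) powr ?q)"
      using assms by (intro continuous_on_powr' continuous_intros) auto
    show "((\<lambda>t. (x - t) powr ?q) has_field_derivative - ?q * (x - t) powr (- \<gamma>)) (at t within {c..x})"
      if "t \<in> {c..x} - {x}" for t
      using that assms by (auto intro!: derivative_eq_intros simp: algebra_simps)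
  qed simp
  moreover have "integral {(x - c) powr ?q..0} ?F = 0"
    by (cases "x = c") auto
  ultimately have "((\<lambda>t. - ?q * ((x - t) powr (- \<gamma>) * f (x - ((x - t) powr ?q) powr (1 / ?q)))) has_integral
      - integral {0..(x - c) powr ?q} ?F) {c..x}"
    by (simp add: mult.assoc)
  then have "((\<lambda>t. - ?q * ((x - t) powr (- \<gamma>) * f t)) has_integral
      - integral {0..(x - c) powr ?q} ?F) {c..x}"
    by (rule has_integral_eq[rotated]) (use assms in \<open>auto simp: powr_powr\<close>)
  then have "((\<lambda>t. - 1 / ?q * (- ?q * ((x - t) powr (- \<gamma>) * f t))) has_integral
      - 1 / ?q * (- integral {0..(x - c) powr ?q} ?F)) {c..x}"
    by (rule has_integral_mult_right)
  moreover have "- 1 / ?q * (- ?q * z) = z" "- 1 / ?q * (- z) = 1 / ?q * z" for z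
    using assms by (simp_all add: field_simps)
  ultimately show ?thesis by (simp only:)
qed

corollary frac_conv_left_integrable:
  fixes f :: "real \<Rightarrow> real"
  assumes "0 < \<gamma>" "\<gamma> < 1" "continuous_on {c..x} f"
  shows "(\<lambda>t. (x - t) powr (- \<gamma>) * f t) integrable_on {c..x}"
proof (cases "c \<le> x")
  case True
  then show ?thesis using frac_conv_left_has_integral[of \<gamma> c x f] assms by blast
qed (simp add: not_le integrable_on_empty)

lemma frac_kernel_integral:
  fixes \<gamma> c x :: real
  assumes "0 < \<gamma>" "\<gamma> < 1" "c \<le> x"
  shows "((\<lambda>t. (x - t) powr (- \<gamma>)) has_integral (x - c) powr (1 - \<gamma>) / (1 - \<gamma>)) {c..x}"
  using frac_conv_left_has_integral[of \<gamma> c x "\<lambda>_. 1"] assms by simp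

lemma frac_conv_left_bound:
  assumes "0 < \<gamma>" "\<gamma> < 1" "c \<le> x" "continuous_on {c..x} f"
    and "\<And>t. t \<in> {c..x} \<Longrightarrow> \<bar>f t\<bar> \<le> M"
  shows "\<bar>frac_conv_left c \<gamma> f x\<bar> \<le> M * ((x - c) powr (1 - \<gamma>) / (1 - \<gamma>))"
proof -
  have "norm (integral {c..x} (\<lambda>t. (x - t) powr (- \<gamma>) * f t)) \<le>
      integral {c..x} (\<lambda>t. M * (x - t) powr (- \<gamma>))"
  proof (rule integral_norm_bound_integral)
    show "(\<lambda>t. (x - t) powr (- \<gamma>) * f t) integrable_on {c..x}"
      by (rule frac_conv_left_integrable) (use assms in auto)
    show "(\<lambda>t. M * (x - t) powr (- \<gamma>)) integrable_on {c..x}"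
      by (rule integrable_on_mult_right) (use frac_kernel_integral[OF assms(1-3)] in blast)
    show "norm ((x - t) powr (- \<gamma>) * f t) \<le> M * (x - t) powr (- \<gamma>)" if "t \<in> {c..x}" for t
      using mult_left_mono[OF assms(5)[OF that], of "(x - t) powr (- \<gamma>)"]
      by (simp add: abs_mult mult.commute)
  qed
  then show ?thesis
    using integral_unique[OF has_integral_mult_right[OF frac_kernel_integral[OF assms(1-3)], of M]]
    by (simp add: frac_conv_left_def)
qed

text \<open>The convolution is of order \<open>(x - c) powr (1 - \<gamma>)\<close>. A continuous
  fractional derivative does not fix the limit of the convolution at the singular endpoint; this
  estimate does, and gives the continuity up to the boundary used in integration by parts.\<close>

lemma frac_conv_left_tendsto_0:
  assumes "0 < \<gamma>" "\<gamma> < 1" "c < d" "continuous_on {c..d} f"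
  shows "(frac_conv_left c \<gamma> f \<longlongrightarrow> 0) (at c within {c..d})"
proof -
  obtain M where "\<forall>z\<in>f ` {c..d}. norm z \<le> M"
    using compact_imp_bounded[OF compact_continuous_image[OF assms(4) compact_Icc]]
    unfolding bounded_iff by blast
  then have M: "\<bar>f t\<bar> \<le> M" if "t \<in> {c..d}" for t
    using that by auto
  have "((\<lambda>x. M * ((x - c) powr (1 - \<gamma>) / (1 - \<gamma>))) \<longlongrightarrow> M * (0 powr (1 - \<gamma>) / (1 - \<gamma>))) (at c within {c..d})"
    using assms by (intro tendsto_intros tendsto_powr2) (auto intro!: tendsto_eq_intros simp: eventually_at_filter)
  then have *: "((\<lambda>x. M * ((x - c) powr (1 - \<gamma>) / (1 - \<gamma>))) \<longlongrightarrow> 0) (at c within {c..d})"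
    by simp
  show ?thesis
  proof (rule Lim_null_comparison[OF _ *])
    have "norm (frac_conv_left c \<gamma> f x) \<le> M * ((x - c) powr (1 - \<gamma>) / (1 - \<gamma>))" if "x \<in> {c..d}" for x
      unfolding real_norm_def
      by (rule frac_conv_left_bound) (use assms that M in \<open>auto intro: continuous_on_subset[OF assms(4)]\<close>)
    then show "\<forall>\<^sub>F x in at c within {c..d}. norm (frac_conv_left c \<gamma> f x) \<le> M * ((x - c) powr (1 - \<gamma>) / (1 - \<gamma>))"
      by (auto simp: eventually_at_filter intro!: always_eventually)
  qed
qed

section \<open>Recognizing and using continuous fractional derivatives\<close>

text \<open>Away from \<open>c\<close> the formula determines the value, and at \<open>c\<close> the
  value is the limit of the others, which continuity of \<open>D\<close> supplies. Later fractional
  derivatives are identified by exhibiting such a \<open>D\<close>.\<close>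

lemma RL_leftI:
  assumes "c < d" "\<gamma> < 1" and D: "continuous_on {c..d} D"
    and der: "\<And>x. x \<in> {c<..d} \<Longrightarrow>
      (frac_conv_left c \<gamma> f has_real_derivative Gamma (1 - \<gamma>) * D x) (at x within {c..d})"
  shows "has_cont_RL_left c d \<gamma> f" and "\<And>x. x \<in> {c..d} \<Longrightarrow> RL_left c d \<gamma> f x = D x"
proof -
  have G: "Gamma (1 - \<gamma>) \<noteq> 0" using assms Gamma_real_pos[of "1 - \<gamma>"] by linarith
  have vd: "1 / Gamma (1 - \<gamma>) * vector_derivative (frac_conv_left c \<gamma> f) (at x within {c..d}) = D x"
    if "x \<in> {c<..d}" for x
    using vector_derivative_within_closed_interval[OF \<open>c < d\<close>, of x "frac_conv_left c \<gamma> f"]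
      der[OF that] that G by (auto simp: has_real_derivative_iff_has_vector_derivative)
  have "(D \<longlongrightarrow> D c) (at_right c)"
    using D assms(1) by (auto simp: continuous_on_def at_within_Icc_at_right dest: bspec[of _ _ c])
  then have "((\<lambda>s. 1 / Gamma (1 - \<gamma>) * vector_derivative (frac_conv_left c \<gamma> f) (at s within {c..d}))
      \<longlongrightarrow> D c) (at_right c)"
    by (rule Lim_transform_eventually)
      (use vd assms(1) in \<open>auto simp: eventually_at_right_field intro!: exI[of _ d]\<close>)
  then have lim: "Lim (at_right c) (\<lambda>s. 1 / Gamma (1 - \<gamma>) *
      vector_derivative (frac_conv_left c \<gamma> f) (at s within {c..d})) = D c"
    by (intro tendsto_Lim) auto
  show RL: "RL_left c d \<gamma> f x = D x" if "x \<in> {c..d}" for x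
    using that vd[of x] lim by (auto simp: RL_left_def Let_def)
  show "has_cont_RL_left c d \<gamma> f"
    unfolding has_cont_RL_left_def
  proof (intro conjI ballI)
    show "continuous_on {c..d} (RL_left c d \<gamma> f)"
      using D RL by (metis (no_types, lifting) continuous_on_cong)
    show "frac_conv_left c \<gamma> f differentiable at x within {c..d}" if "x \<in> {c<..d}" for x
      using der[OF that] real_differentiable_def by blast
  qed
qed

lemma has_cont_RL_leftD:
  assumes "\<gamma> < 1" "has_cont_RL_left c d \<gamma> f" "x \<in> {c<..d}"
  shows "(frac_conv_left c \<gamma> f has_real_derivative Gamma (1 - \<gamma>) * RL_left c d \<gamma> f x) (at x within {c..d})"
proof -
  have G: "Gamma (1 - \<gamma>) \<noteq> 0" using assms Gamma_real_pos[of "1 - \<gamma>"] by linarith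
  have "(frac_conv_left c \<gamma> f has_vector_derivative
      vector_derivative (frac_conv_left c \<gamma> f) (at x within {c..d})) (at x within {c..d})"
    using assms by (auto simp: has_cont_RL_left_def vector_derivative_works)
  then show ?thesis
    using assms G by (auto simp: RL_left_def Let_def has_real_derivative_iff_has_vector_derivative)
qed

lemma RL_rightI:
  assumes "c < d" "\<gamma> < 1" and D: "continuous_on {c..d} D"
    and der: "\<And>x. x \<in> {c..<d} \<Longrightarrow>
      (frac_conv_right d \<gamma> f has_real_derivative - Gamma (1 - \<gamma>) * D x) (at x within {c..d})"
  shows "has_cont_RL_right c d \<gamma> f" and "\<And>x. x \<in> {c..d} \<Longrightarrow> RL_right c d \<gamma> f x = D x"
proof -
  have G: "Gamma (1 - \<gamma>) \<noteq> 0" using assms Gamma_real_pos[of "1 - \<gamma>"] by linarith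
  have vd: "- 1 / Gamma (1 - \<gamma>) * vector_derivative (frac_conv_right d \<gamma> f) (at x within {c..d}) = D x"
    if "x \<in> {c..<d}" for x
    using vector_derivative_within_closed_interval[OF \<open>c < d\<close>, of x "frac_conv_right d \<gamma> f"]
      der[OF that] that G by (auto simp: has_real_derivative_iff_has_vector_derivative)
  have "(D \<longlongrightarrow> D d) (at_left d)"
    using D assms(1) by (auto simp: continuous_on_def at_within_Icc_at_left dest: bspec[of _ _ d])
  then have "((\<lambda>s. - 1 / Gamma (1 - \<gamma>) * vector_derivative (frac_conv_right d \<gamma> f) (at s within {c..d}))
      \<longlongrightarrow> D d) (at_left d)"
    by (rule Lim_transform_eventually)
      (use vd assms(1) in \<open>auto simp: eventually_at_left_field intro!: exI[of _ c]\<close>)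
  then have lim: "Lim (at_left d) (\<lambda>s. - 1 / Gamma (1 - \<gamma>) *
      vector_derivative (frac_conv_right d \<gamma> f) (at s within {c..d})) = D d"
    by (intro tendsto_Lim) auto
  show RL: "RL_right c d \<gamma> f x = D x" if "x \<in> {c..d}" for x
    using that vd[of x] lim by (auto simp: RL_right_def Let_def)
  show "has_cont_RL_right c d \<gamma> f"
    unfolding has_cont_RL_right_def
  proof (intro conjI ballI)
    show "continuous_on {c..d} (RL_right c d \<gamma> f)"
      using D RL by (metis (no_types, lifting) continuous_on_cong)
    show "frac_conv_right d \<gamma> f differentiable at x within {c..d}" if "x \<in> {c..<d}" for x
      using der[OF that] real_differentiable_def by blast
  qed
qed

lemma has_cont_RL_rightD:
  assumes "\<gamma> < 1" "has_cont_RL_right c d \<gamma> f" "x \<in> {c..<d}"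
  shows "(frac_conv_right d \<gamma> f has_real_derivative - Gamma (1 - \<gamma>) * RL_right c d \<gamma> f x) (at x within {c..d})"
proof -
  have G: "Gamma (1 - \<gamma>) \<noteq> 0" using assms Gamma_real_pos[of "1 - \<gamma>"] by linarith
  have "(frac_conv_right d \<gamma> f has_vector_derivative
      vector_derivative (frac_conv_right d \<gamma> f) (at x within {c..d})) (at x within {c..d})"
    using assms by (auto simp: has_cont_RL_right_def vector_derivative_works)
  then show ?thesis
    using assms G by (auto simp: RL_right_def Let_def has_real_derivative_iff_has_vector_derivative)
qed

section \<open>Reflection and linearity\<close>

text \<open>Substituting \<open>- t\<close> for \<open>t\<close> exchanges the two convolutions.
  Through it linearity, the limit at the singular endpoint, the treatment of test functions and
  integration by parts pass from one side to the other.\<close>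

lemma frac_conv_left_eq_right_reflect:
  "frac_conv_left c \<gamma> f x = frac_conv_right (- c) \<gamma> (\<lambda>t. f (- t)) (- x)"
  using Henstock_Kurzweil_Integration.integral_reflect_real[of x c "\<lambda>t. (x - t) powr (- \<gamma>) * f t"]
  by (simp add: frac_conv_left_def frac_conv_right_def add.commute)

lemma frac_conv_right_eq_left_reflect:
  "frac_conv_right d \<gamma> f x = frac_conv_left (- d) \<gamma> (\<lambda>t. f (- t)) (- x)"
  using frac_conv_left_eq_right_reflect[of "- d" \<gamma> "\<lambda>t. f (- t)" "- x"] by simp

lemma RL_left_reflect:
  assumes "c < d" "\<gamma> < 1" "has_cont_RL_left c d \<gamma> f"
  shows "has_cont_RL_right (- d) (- c) \<gamma> (\<lambda>t. f (- t))"
    and "\<And>x. x \<in> {c..d} \<Longrightarrow> RL_right (- d) (- c) \<gamma> (\<lambda>t. f (- t)) (- x) = RL_left c d \<gamma> f x"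
proof -
  let ?D = "\<lambda>x. RL_left c d \<gamma> f (- x)"
  have cont: "continuous_on {- d..- c} ?D"
    by (rule continuous_on_compose2[of "{c..d}" "RL_left c d \<gamma> f"])
      (use assms in \<open>auto simp: has_cont_RL_left_def intro!: continuous_intros\<close>)
  have eq: "frac_conv_right (- c) \<gamma> (\<lambda>t. f (- t)) = (\<lambda>x. frac_conv_left c \<gamma> f (- x))"
    by (rule ext) (simp add: frac_conv_right_eq_left_reflect)
  have der: "(frac_conv_right (- c) \<gamma> (\<lambda>t. f (- t)) has_real_derivative - Gamma (1 - \<gamma>) * ?D x)
      (at x within {- d..- c})" if "x \<in> {- d..<- c}" for x
  proof -
    have im: "uminus ` {- d..- c} = {c..d}" by (simp add: )
    \<comment> \<open>The factor \<open>- 1\<close> of the chain rule is the minus sign in the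
      definition of \<open>RL_right\<close>.\<close>
    have "((\<lambda>x. frac_conv_left c \<gamma> f (- x)) has_real_derivative
        (Gamma (1 - \<gamma>) * ?D x) * (- 1)) (at x within {- d..- c})"
      by (rule DERIV_image_chain[unfolded o_def, where f = "frac_conv_left c \<gamma> f" and g = uminus])
        (use that has_cont_RL_leftD[OF assms(2,3), of "- x"] in
          \<open>auto simp: im intro!: derivative_eq_intros\<close>)
    then show ?thesis by (simp add: eq)
  qed
  show "has_cont_RL_right (- d) (- c) \<gamma> (\<lambda>t. f (- t))"
    by (rule RL_rightI[OF _ _ cont der]) (use assms in auto)
  show "RL_right (- d) (- c) \<gamma> (\<lambda>t. f (- t)) (- x) = RL_left c d \<gamma> f x" if "x \<in> {c..d}" for x
    using RL_rightI(2)[OF _ _ cont der, of "- x"] that assms by auto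
qed

text \<open>Continuity of \<open>f\<close> and \<open>h\<close> allows the convolution integral to
  be split. The combination \<open>k\<close> is tied to \<open>f\<close> and \<open>h\<close> on
  \<open>{c..d}\<close> only, because the partial derivatives of \<open>L - lam * g\<close> are
  later combined only for \<open>x\<close> in \<open>[a,b]\<close>.\<close>

lemma RL_left_linear:
  assumes "c < d" "0 < \<gamma>" "\<gamma> < 1" "continuous_on {c..d} f" "continuous_on {c..d} h"
    and "has_cont_RL_left c d \<gamma> f" "has_cont_RL_left c d \<gamma> h"
    and k: "\<And>x. x \<in> {c..d} \<Longrightarrow> k x = f x + r * h x"
  shows "has_cont_RL_left c d \<gamma> k"
    and "\<And>x. x \<in> {c..d} \<Longrightarrow> RL_left c d \<gamma> k x = RL_left c d \<gamma> f x + r * RL_left c d \<gamma> h x"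
proof -
  have cont: "continuous_on {c..d} (\<lambda>x. RL_left c d \<gamma> f x + r * RL_left c d \<gamma> h x)"
    using assms by (auto simp: has_cont_RL_left_def intro!: continuous_intros)
  have eq: "frac_conv_left c \<gamma> k x = frac_conv_left c \<gamma> f x + r * frac_conv_left c \<gamma> h x"
    if "x \<in> {c..d}" for x
  proof -
    have "(\<lambda>t. (x - t) powr (- \<gamma>) * f t) integrable_on {c..x}"
      "(\<lambda>t. r * ((x - t) powr (- \<gamma>) * h t)) integrable_on {c..x}"
      using assms that by (auto intro!: frac_conv_left_integrable integrable_on_mult_right
          continuous_on_subset[of "{c..d}" _ "{c..x}"])
    from integral_add[OF this] have "frac_conv_left c \<gamma> f x + r * frac_conv_left c \<gamma> h x =
        integral {c..x} (\<lambda>t. (x - t) powr (- \<gamma>) * f t + r * ((x - t) powr (- \<gamma>) * h t))"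
      by (simp add: frac_conv_left_def)
    also have "\<dots> = frac_conv_left c \<gamma> k x"
      unfolding frac_conv_left_def by (rule integral_cong) (use that k in \<open>auto simp: algebra_simps\<close>)
    finally show ?thesis ..
  qed
  have der: "(frac_conv_left c \<gamma> k has_real_derivative
      Gamma (1 - \<gamma>) * (RL_left c d \<gamma> f x + r * RL_left c d \<gamma> h x)) (at x within {c..d})"
    if "x \<in> {c<..d}" for x
  proof -
    have "((\<lambda>x. frac_conv_left c \<gamma> f x + r * frac_conv_left c \<gamma> h x) has_real_derivative
        Gamma (1 - \<gamma>) * RL_left c d \<gamma> f x + r * (Gamma (1 - \<gamma>) * RL_left c d \<gamma> h x)) (at x within {c..d})"
      by (intro DERIV_add DERIV_cmult has_cont_RL_leftD) (use assms that in auto)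
    from has_derivative_transform[OF _ eq this[unfolded has_field_derivative_def]] show ?thesis
      using that by (auto simp: has_field_derivative_def algebra_simps)
  qed
  show "has_cont_RL_left c d \<gamma> k"
    by (rule RL_leftI(1)[OF _ _ cont der]) (use assms in auto)
  show "RL_left c d \<gamma> k x = RL_left c d \<gamma> f x + r * RL_left c d \<gamma> h x"
    if "x \<in> {c..d}" for x
    using RL_leftI(2)[OF _ _ cont der, of x] that assms by auto
qed

lemma RL_right_reflect:
  assumes "c < d" "\<gamma> < 1" "has_cont_RL_right c d \<gamma> f"
  shows "has_cont_RL_left (- d) (- c) \<gamma> (\<lambda>t. f (- t))"
    and "\<And>x. x \<in> {c..d} \<Longrightarrow> RL_left (- d) (- c) \<gamma> (\<lambda>t. f (- t)) (- x) = RL_right c d \<gamma> f x"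
proof -
  let ?D = "\<lambda>x. RL_right c d \<gamma> f (- x)"
  have cont: "continuous_on {- d..- c} ?D"
    by (rule continuous_on_compose2[of "{c..d}" "RL_right c d \<gamma> f"])
      (use assms in \<open>auto simp: has_cont_RL_right_def intro!: continuous_intros\<close>)
  have eq: "frac_conv_left (- d) \<gamma> (\<lambda>t. f (- t)) = (\<lambda>x. frac_conv_right d \<gamma> f (- x))"
    by (rule ext) (simp add: frac_conv_left_eq_right_reflect)
  have der: "(frac_conv_left (- d) \<gamma> (\<lambda>t. f (- t)) has_real_derivative Gamma (1 - \<gamma>) * ?D x)
      (at x within {- d..- c})" if "x \<in> {- d<..- c}" for x
  proof -
    have im: "uminus ` {- d..- c} = {c..d}" by simp
    have "((\<lambda>x. frac_conv_right d \<gamma> f (- x)) has_real_derivative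
        (- Gamma (1 - \<gamma>) * ?D x) * (- 1)) (at x within {- d..- c})"
      by (rule DERIV_image_chain[unfolded o_def, where f = "frac_conv_right d \<gamma> f" and g = uminus])
        (use that has_cont_RL_rightD[OF assms(2,3), of "- x"] in
          \<open>auto simp: im intro!: derivative_eq_intros\<close>)
    then show ?thesis by (simp add: eq)
  qed
  show "has_cont_RL_left (- d) (- c) \<gamma> (\<lambda>t. f (- t))"
    by (rule RL_leftI[OF _ _ cont der]) (use assms in auto)
  show "RL_left (- d) (- c) \<gamma> (\<lambda>t. f (- t)) (- x) = RL_right c d \<gamma> f x" if "x \<in> {c..d}" for x
    using RL_leftI(2)[OF _ _ cont der, of "- x"] that assms by auto
qed

lemma RL_right_linear:
  assumes "c < d" "0 < \<gamma>" "\<gamma> < 1" "continuous_on {c..d} f" "continuous_on {c..d} h"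
    and "has_cont_RL_right c d \<gamma> f" "has_cont_RL_right c d \<gamma> h"
    and k: "\<And>x. x \<in> {c..d} \<Longrightarrow> k x = f x + r * h x"
  shows "has_cont_RL_right c d \<gamma> k"
    and "\<And>x. x \<in> {c..d} \<Longrightarrow> RL_right c d \<gamma> k x = RL_right c d \<gamma> f x + r * RL_right c d \<gamma> h x"
proof -
  have cont: "continuous_on {- d..- c} (\<lambda>t. f (- t))" "continuous_on {- d..- c} (\<lambda>t. h (- t))"
    by (rule continuous_on_compose2[OF assms(4)] continuous_on_compose2[OF assms(5)];
      auto intro!: continuous_intros)+
  have k': "k (- x) = f (- x) + r * h (- x)" if "x \<in> {- d..- c}" for x
    using that by (intro k) auto
  have less: "- d < - c" using assms by simp
  note lin = RL_left_linear[OF less assms(2,3) cont RL_right_reflect(1)[OF assms(1,3,6)]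
      RL_right_reflect(1)[OF assms(1,3,7)], of "\<lambda>t. k (- t)" r, OF k']
  show K: "has_cont_RL_right c d \<gamma> k"
    using RL_left_reflect(1)[OF less assms(3) lin(1)] by simp
  show "RL_right c d \<gamma> k x = RL_right c d \<gamma> f x + r * RL_right c d \<gamma> h x" if "x \<in> {c..d}" for x
    using lin(2)[of "- x"] that unfolding RL_right_reflect(2)[OF assms(1,3,6) that]
      RL_right_reflect(2)[OF assms(1,3,7) that] RL_right_reflect(2)[OF assms(1,3) K that] by simp
qed

section \<open>Test functions and integration by parts\<close>

text \<open>The derivative is carried as data. That both functions vanish left of \<open>a\<close>
  makes \<open>frac_conv_left_substitution\<close> applicable to both; that \<eta> vanishes at
  \<open>a\<close> and \<open>b\<close> preserves boundary values and removes boundary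
  terms.\<close>

definition C1_test :: "real \<Rightarrow> real \<Rightarrow> (real \<Rightarrow> real) \<Rightarrow> (real \<Rightarrow> real) \<Rightarrow> bool" where
  "C1_test a b \<eta> \<eta>' \<longleftrightarrow> (\<forall>t. (\<eta> has_real_derivative \<eta>' t) (at t)) \<and> continuous_on UNIV \<eta>' \<and>
    (\<forall>t. t \<le> a \<or> b \<le> t \<longrightarrow> \<eta> t = 0 \<and> \<eta>' t = 0)"

lemma C1_test_continuous: "C1_test a b \<eta> \<eta>' \<Longrightarrow> continuous_on S \<eta>"
  by (meson C1_test_def DERIV_continuous_on has_field_derivative_at_within)

lemma C1_test_deriv_continuous: "C1_test a b \<eta> \<eta>' \<Longrightarrow> continuous_on S \<eta>'"
  by (meson C1_test_def continuous_on_subset subset_UNIV)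

lemma C1_test_reflect:
  assumes "C1_test a b \<eta> \<eta>'"
  shows "C1_test (- b) (- a) (\<lambda>t. \<eta> (- t)) (\<lambda>t. - \<eta>' (- t))"
  unfolding C1_test_def
proof (intro conjI allI impI)
  show "((\<lambda>t. \<eta> (- t)) has_real_derivative - \<eta>' (- t)) (at t)" for t
    using assms DERIV_mirror[of \<eta> "\<eta>' (- t)" t] by (simp add: C1_test_def)
  show "continuous_on UNIV (\<lambda>t. - \<eta>' (- t))"
    by (intro continuous_intros continuous_on_compose2[OF C1_test_deriv_continuous[OF assms, of UNIV]]) auto
  show "\<eta> (- t) = 0" "- \<eta>' (- t) = 0" if "t \<le> - b \<or> - a \<le> t" for t
    using assms that by (auto simp: C1_test_def le_minus_iff minus_le_iff)
qed

text \<open>The substitution \<open>t = x - r powr (1 / (1 - \<gamma>))\<close> turns the convolution into an integral with a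
  bounded integrand over an interval that does not depend on \<open>x\<close>.\<close>

lemma frac_conv_left_substitution:
  assumes "0 < \<gamma>" "\<gamma> < 1" "x \<in> {c..d}" "continuous_on UNIV f" "\<And>t. t \<le> c \<Longrightarrow> f t = 0"
  shows "frac_conv_left c \<gamma> f x =
    1 / (1 - \<gamma>) * integral {0..(d - c) powr (1 - \<gamma>)} (\<lambda>r. f (x - r powr (1 / (1 - \<gamma>))))"
proof -
  let ?F = "\<lambda>r. f (x - r powr (1 / (1 - \<gamma>)))"
  let ?A = "(x - c) powr (1 - \<gamma>)" and ?R = "(d - c) powr (1 - \<gamma>)"
  \<comment> \<open>From \<open>?A\<close> on, the argument of \<open>f\<close> lies at or below
    \<open>c\<close>, where \<open>f\<close> is 0; so the upper limit can be raised to
    \<open>?R\<close>, which does not depend on \<open>x\<close>.\<close>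
  have zero: "?F r = 0" if "?A \<le> r" for r
  proof -
    have "?A powr (1 / (1 - \<gamma>)) \<le> r powr (1 / (1 - \<gamma>))"
      using that assms by (intro powr_mono2) auto
    then have "x - r powr (1 / (1 - \<gamma>)) \<le> c" using assms by (simp add: powr_powr)
    then show ?thesis by (rule assms(5))
  qed
  have "?F integrable_on {0..?R}"
    by (intro integrable_continuous_real continuous_on_compose2[OF assms(4)] continuous_intros
        continuous_on_powr') (use assms in auto)
  moreover have "?A \<le> ?R" using assms by (intro powr_mono2) auto
  ultimately have "integral {0..?A} ?F + integral {?A..?R} ?F = integral {0..?R} ?F"
    by (intro Henstock_Kurzweil_Integration.integral_combine) auto
  moreover have "integral {?A..?R} ?F = integral {?A..?R} (\<lambda>_. 0)"
    by (rule integral_cong) (use zero in auto)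
  ultimately have "integral {0..?R} ?F = integral {0..?A} ?F" by simp
  moreover have "continuous_on {c..x} f" using assms(4) continuous_on_subset by blast
  ultimately show ?thesis
    using integral_unique[OF frac_conv_left_has_integral[of \<gamma> c x f]] assms
    by (auto simp: frac_conv_left_def)
qed

text \<open>After the substitution \<open>x\<close> occurs only inside \<eta>, so the Leibniz rule
  applies on a fixed interval with the continuous derivative \<eta>'. As \<eta> vanishes at
  \<open>a\<close>, its Riemann-Liouville derivative is its Caputo derivative.\<close>

lemma frac_conv_left_test:
  assumes "0 < \<gamma>" "\<gamma> < 1" "C1_test a b \<eta> \<eta>'"
  shows "continuous_on {a..b} (frac_conv_left a \<gamma> \<eta>')"
    and "x \<in> {a..b} \<Longrightarrow>
      (frac_conv_left a \<gamma> \<eta> has_real_derivative frac_conv_left a \<gamma> \<eta>' x) (at x within {a..b})"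
proof -
  let ?R = "(b - a) powr (1 - \<gamma>)"
  let ?I = "\<lambda>f x. 1 / (1 - \<gamma>) * integral {0..?R} (\<lambda>r. f (x - r powr (1 / (1 - \<gamma>))))"
  have cont: "continuous_on UNIV \<eta>" "continuous_on UNIV \<eta>'"
    using assms C1_test_continuous C1_test_deriv_continuous by blast+
  have eq: "frac_conv_left a \<gamma> \<eta> x = ?I \<eta> x" "frac_conv_left a \<gamma> \<eta>' x = ?I \<eta>' x" if "x \<in> {a..b}" for x
    by (rule frac_conv_left_substitution[OF assms(1,2) that]; use assms cont in \<open>simp add: C1_test_def\<close>)+
  have contp: "continuous_on (UNIV \<times> cbox 0 ?R) (\<lambda>(x, r). \<eta>' (x - r powr (1 / (1 - \<gamma>))))"
    unfolding split_beta
    by (intro continuous_on_compose2[OF cont(2)] continuous_intros continuous_on_powr')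
      (use assms in auto)
  have "continuous_on {a..b} (?I \<eta>')"
    using continuous_on_subset[OF integral_continuous_on_param[OF contp] subset_UNIV] assms
    by (intro continuous_intros) (auto simp: cbox_interval)
  then show "continuous_on {a..b} (frac_conv_left a \<gamma> \<eta>')"
    by (subst continuous_on_cong[OF refl eq(2)])
  assume x: "x \<in> {a..b}"
  have "((\<lambda>x. integral (cbox 0 ?R) (\<lambda>r. \<eta> (x - r powr (1 / (1 - \<gamma>))))) has_field_derivative
      integral (cbox 0 ?R) (\<lambda>r. \<eta>' (x - r powr (1 / (1 - \<gamma>))))) (at x within UNIV)"
  proof (rule leibniz_rule_field_derivative[OF _ _ contp])
    show "((\<lambda>x. \<eta> (x - r powr (1 / (1 - \<gamma>)))) has_real_derivative \<eta>' (x - r powr (1 / (1 - \<gamma>)))) (at x)"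
      for x r
    proof -
      have "((\<lambda>x. \<eta> (x - r powr (1 / (1 - \<gamma>)))) has_real_derivative \<eta>' (x - r powr (1 / (1 - \<gamma>))) * 1) (at x)"
        by (rule DERIV_chain2[where f = \<eta>])
          (use assms in \<open>auto simp: C1_test_def intro!: derivative_eq_intros\<close>)
      then show ?thesis by simp
    qed
    show "(\<lambda>r. \<eta> (x - r powr (1 / (1 - \<gamma>)))) integrable_on cbox 0 ?R" for x
      unfolding cbox_interval
      by (intro integrable_continuous_real continuous_on_compose2[OF cont(1)] continuous_intros
          continuous_on_powr') (use assms in auto)
  qed auto
  then have "(?I \<eta> has_real_derivative ?I \<eta>' x) (at x within {a..b})"
    by (intro DERIV_cmult) (auto intro: has_field_derivative_at_within)
  from has_derivative_transform[OF x eq(1) this[unfolded has_field_derivative_def]]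
  show "(frac_conv_left a \<gamma> \<eta> has_real_derivative frac_conv_left a \<gamma> \<eta>' x) (at x within {a..b})"
    using eq(2)[OF x] by (simp add: has_field_derivative_def)
qed

lemma RL_left_test:
  assumes "a < b" "0 < \<gamma>" "\<gamma> < 1" "C1_test a b \<eta> \<eta>'"
  shows "has_cont_RL_left a b \<gamma> \<eta>"
    and "x \<in> {a..b} \<Longrightarrow> RL_left a b \<gamma> \<eta> x = frac_conv_left a \<gamma> \<eta>' x / Gamma (1 - \<gamma>)"
proof -
  have G: "Gamma (1 - \<gamma>) \<noteq> 0" using assms Gamma_real_pos[of "1 - \<gamma>"] by linarith
  have cont: "continuous_on {a..b} (\<lambda>x. frac_conv_left a \<gamma> \<eta>' x / Gamma (1 - \<gamma>))"
    using frac_conv_left_test(1)[OF assms(2-4)] G by (intro continuous_intros) auto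
  have der: "(frac_conv_left a \<gamma> \<eta> has_real_derivative
      Gamma (1 - \<gamma>) * (frac_conv_left a \<gamma> \<eta>' x / Gamma (1 - \<gamma>))) (at x within {a..b})"
    if "x \<in> {a<..b}" for x
    using frac_conv_left_test(2)[OF assms(2-4), of x] that G by simp
  show "has_cont_RL_left a b \<gamma> \<eta>"
    by (rule RL_leftI[OF assms(1,3) cont der])
  show "RL_left a b \<gamma> \<eta> x = frac_conv_left a \<gamma> \<eta>' x / Gamma (1 - \<gamma>)" if "x \<in> {a..b}"
    by (rule RL_leftI(2)[OF assms(1,3) cont der that])
qed

lemma RL_right_test:
  assumes "a < b" "0 < \<gamma>" "\<gamma> < 1" "C1_test a b \<eta> \<eta>'"
  shows "has_cont_RL_right a b \<gamma> \<eta>"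
  using RL_left_reflect(1)[OF _ _ RL_left_test(1)[OF _ _ _ C1_test_reflect[OF assms(4)]], of \<gamma>] assms
  by simp

section \<open>Fubini for the singular kernel and integration by parts\<close>

text \<open>Tonelli on the triangle \<open>a \<le> t \<le> x \<le> b\<close>: the kernel is
  nonnegative, and its integral over \<open>t\<close> is
  \<open>(x - a) powr (1 - \<gamma>) / (1 - \<gamma>)\<close>, continuous in \<open>x\<close>. A
  multiple of the kernel later dominates the integrand in the Fubini argument.\<close>

lemma frac_kernel_bochner:
  fixes \<gamma> a x b :: real
  defines "k \<equiv> \<lambda>x t. if a \<le> t \<and> t \<le> x \<and> x \<le> b then (x - t) powr (- \<gamma>) else 0"
  assumes "0 < \<gamma>" "\<gamma> < 1"
  shows "integrable (lborel \<Otimes>\<^sub>M lborel) (case_prod k)"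
    and "integrable lborel (k x)" "integrable lborel (\<lambda>x. k x t)"
proof -
  have meas[measurable]: "case_prod k \<in> borel_measurable (lborel \<Otimes>\<^sub>M lborel)"
    unfolding k_def split_beta by measurable
  have mx: "k x \<in> borel_measurable lborel" for x unfolding k_def by measurable
  have mt: "(\<lambda>x. k x t) \<in> borel_measurable lborel" for t unfolding k_def by measurable
  have nonneg: "0 \<le> k x t" for x t by (simp add: k_def)
  have hx: "has_bochner_integral lborel (k x) ((x - a) powr (1 - \<gamma>) / (1 - \<gamma>))" if "x \<in> {a..b}" for x
  proof (rule has_bochner_integral_nn_integral)
    have "((\<lambda>t. (x - t) powr (- \<gamma>)) has_integral (x - a) powr (1 - \<gamma>) / (1 - \<gamma>)) {a..x}"
      using frac_kernel_integral assms that by auto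
    then have "((\<lambda>t. if t \<in> {a..x} then (x - t) powr (- \<gamma>) else 0) has_integral
        (x - a) powr (1 - \<gamma>) / (1 - \<gamma>)) UNIV"
      by (simp only: has_integral_restrict_UNIV)
    moreover have "(\<lambda>t. if t \<in> {a..x} then (x - t) powr (- \<gamma>) else 0) = k x"
      using that by (auto simp: k_def)
    ultimately have "(k x has_integral (x - a) powr (1 - \<gamma>) / (1 - \<gamma>)) UNIV" by simp
    from nn_integral_has_integral_lborel[OF _ _ this] 
    show "(\<integral>\<^sup>+ t. ennreal (k x t) \<partial>lborel) = ennreal ((x - a) powr (1 - \<gamma>) / (1 - \<gamma>))"
      using mx nonneg by simp
  qed (use mx nonneg assms in auto)
  have k0: "k x = (\<lambda>_. 0)" if "x \<notin> {a..b}" for x using that by (auto simp: k_def)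
  show ix: "integrable lborel (k x)" for x
    by (cases "x \<in> {a..b}") (use hx[of x] k0[of x] in \<open>auto simp: has_bochner_integral_iff\<close>)
  show "integrable lborel (\<lambda>x. k x t)"
  proof (cases "t \<in> {a..b}")
    case True
    \<comment> \<open>As a function of \<open>x\<close> the kernel is singular at the left end
      \<open>x = t\<close>; reflection reduces this case to
      \<open>frac_kernel_integral\<close>.\<close>
    have "((\<lambda>s. (- t - s) powr (- \<gamma>)) has_integral (- t - - b) powr (1 - \<gamma>) / (1 - \<gamma>)) {- b..- t}"
      by (rule frac_kernel_integral) (use assms True in auto)
    then have "((\<lambda>x. (x - t) powr (- \<gamma>)) has_integral (b - t) powr (1 - \<gamma>) / (1 - \<gamma>)) {t..b}"
      by (subst has_integral_reflect_real[symmetric]) (simp add: minus_diff_commute)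
    then have "((\<lambda>x. if x \<in> {t..b} then (x - t) powr (- \<gamma>) else 0) has_integral
        (b - t) powr (1 - \<gamma>) / (1 - \<gamma>)) UNIV"
      by (simp only: has_integral_restrict_UNIV)
    moreover have "(\<lambda>x. if x \<in> {t..b} then (x - t) powr (- \<gamma>) else 0) = (\<lambda>x. k x t)"
      using True by (auto simp: k_def)
    ultimately have *: "((\<lambda>x. k x t) has_integral (b - t) powr (1 - \<gamma>) / (1 - \<gamma>)) UNIV" by simp
    have "has_bochner_integral lborel (\<lambda>x. k x t) ((b - t) powr (1 - \<gamma>) / (1 - \<gamma>))"
      by (rule has_bochner_integral_nn_integral)
        (use mt nonneg assms nn_integral_has_integral_lborel[OF _ _ *] in auto)
    then show ?thesis by (simp add: has_bochner_integral_iff)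
  next
    case False
    then have "(\<lambda>x. k x t) = (\<lambda>_. 0)" by (auto simp: k_def)
    then show ?thesis by simp
  qed
  show "integrable (lborel \<Otimes>\<^sub>M lborel) (case_prod k)"
  proof (rule lborel_pair.Fubini_integrable[OF meas])
    have "set_integrable lborel {a..b} (\<lambda>x. (x - a) powr (1 - \<gamma>) / (1 - \<gamma>))"
      by (rule borel_integrable_atLeastAtMost') (use assms in \<open>auto intro!: continuous_intros continuous_on_powr'\<close>)
    moreover have "indicator {a..b} x *\<^sub>R ((x - a) powr (1 - \<gamma>) / (1 - \<gamma>)) = (\<integral>t. norm (case_prod k (x, t)) \<partial>lborel)" for x
      by (cases "x \<in> {a..b}") (use hx[of x] k0[of x] nonneg in \<open>auto simp: has_bochner_integral_iff\<close>)
    ultimately show "integrable lborel (\<lambda>x. \<integral>t. norm (case_prod k (x, t)) \<partial>lborel)"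
      by (simp add: set_integrable_def)
  qed (use ix in auto)
qed

text \<open>Seen from \<open>t\<close>, the same kernel on the triangle is that of the right
  convolution, so exchanging the order of integration moves the convolution from \<psi> to
  \<phi>.\<close>

lemma frac_conv_fubini:
  assumes "0 < \<gamma>" "\<gamma> < 1" "continuous_on {a..b} \<phi>" "continuous_on {a..b} \<psi>"
  shows "integral {a..b} (\<lambda>x. \<phi> x * frac_conv_left a \<gamma> \<psi> x) =
    integral {a..b} (\<lambda>t. \<psi> t * frac_conv_right b \<gamma> \<phi> t)"
proof -
  define k where "k x t = (if a \<le> t \<and> t \<le> x \<and> x \<le> b then (x - t) powr (- \<gamma>) else 0)" for x t
  \<comment> \<open>Extension by zero, because \<phi> and \<psi> are arbitrary off
    \<open>{a..b}\<close> and may fail to be measurable there.\<close>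
  define p where "p x = indicator {a..b} x *\<^sub>R \<phi> x" for x
  define q where "q t = indicator {a..b} t *\<^sub>R \<psi> t" for t
  have [measurable]: "p \<in> borel_measurable borel" "q \<in> borel_measurable borel"
    unfolding p_def q_def
    by (rule borel_measurable_continuous_on_indicator; use assms in simp)+
  have [measurable]: "case_prod k \<in> borel_measurable (lborel \<Otimes>\<^sub>M lborel)"
    unfolding k_def split_beta by measurable
  note ker = frac_kernel_bochner[where a = a and b = b, OF assms(1,2), folded k_def]
  obtain M1 where M1: "\<forall>z\<in>\<phi> ` {a..b}. norm z \<le> M1"
    using compact_imp_bounded[OF compact_continuous_image[OF assms(3) compact_Icc]]
    unfolding bounded_iff by blast
  obtain M2 where M2: "\<forall>z\<in>\<psi> ` {a..b}. norm z \<le> M2"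
    using compact_imp_bounded[OF compact_continuous_image[OF assms(4) compact_Icc]]
    unfolding bounded_iff by blast
  let ?h = "\<lambda>x t. p x * (q t * k x t)"
  have nk: "0 \<le> k x t" for x t by (simp add: k_def)
  \<comment> \<open>Absolute values are taken because \<open>M1\<close> and \<open>M2\<close> may be
    negative when \<open>{a..b}\<close> is empty.\<close>
  have bound: "norm (?h x t) \<le> norm ((\<bar>M1\<bar> * \<bar>M2\<bar>) * k x t)" for x t
  proof -
    have "\<bar>p x\<bar> \<le> \<bar>M1\<bar>" using M1 by (fastforce simp: p_def indicator_def intro: order_trans[OF _ abs_ge_self])
    moreover have "\<bar>q t\<bar> \<le> \<bar>M2\<bar>" using M2 by (fastforce simp: q_def indicator_def intro: order_trans[OF _ abs_ge_self])
    ultimately have "\<bar>p x\<bar> * \<bar>q t\<bar> \<le> \<bar>M1\<bar> * \<bar>M2\<bar>" by (intro mult_mono) auto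
    from mult_right_mono[OF this nk] show ?thesis by (simp add: abs_mult nk mult.assoc)
  qed
  have int: "integrable (lborel \<Otimes>\<^sub>M lborel) (case_prod ?h)"
  proof (rule Bochner_Integration.integrable_bound)
    show "integrable (lborel \<Otimes>\<^sub>M lborel) (\<lambda>z. (\<bar>M1\<bar> * \<bar>M2\<bar>) * case_prod k z)"
      by (rule integrable_mult_right) (use ker in auto)
    show "case_prod ?h \<in> borel_measurable (lborel \<Otimes>\<^sub>M lborel)"
      unfolding split_beta k_def by measurable
    show "AE z in lborel \<Otimes>\<^sub>M lborel. norm (case_prod ?h z) \<le> norm ((\<bar>M1\<bar> * \<bar>M2\<bar>) * case_prod k z)"
      using bound by (auto simp: split_beta)
  qed
  have ix: "integrable lborel (?h x)" for x
  proof (rule Bochner_Integration.integrable_bound)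
    show "integrable lborel (\<lambda>t. (\<bar>M1\<bar> * \<bar>M2\<bar>) * k x t)"
      by (rule integrable_mult_right) (use ker in auto)
    show "?h x \<in> borel_measurable lborel" unfolding k_def by measurable
  qed (use bound in auto)
  have it: "integrable lborel (\<lambda>x. ?h x t)" for t
  proof (rule Bochner_Integration.integrable_bound)
    show "integrable lborel (\<lambda>x. (\<bar>M1\<bar> * \<bar>M2\<bar>) * k x t)"
      by (rule integrable_mult_right) (use ker in auto)
    show "(\<lambda>x. ?h x t) \<in> borel_measurable lborel" unfolding k_def by measurable
  qed (use bound in auto)
  \<comment> \<open>The convolutions are gauge integrals whereas Fubini speaks of Lebesgue
    integrals; Lebesgue integrability of the slices makes the two agree.\<close>
  have inner_t: "(\<integral>t. ?h x t \<partial>lborel) = (if x \<in> {a..b} then \<phi> x * frac_conv_left a \<gamma> \<psi> x else 0)" for x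
  proof -
    have "(\<integral>t. ?h x t \<partial>lborel) = integral UNIV (?h x)"
      by (rule integral_lborel[symmetric, OF ix])
    also have "\<dots> = integral UNIV (\<lambda>t. if t \<in> {a..x} then p x * ((x - t) powr (- \<gamma>) * \<psi> t) else 0)"
      by (rule arg_cong[where f = "integral UNIV"]) (auto simp: p_def q_def k_def indicator_def)
    also have "\<dots> = p x * frac_conv_left a \<gamma> \<psi> x"
      by (simp only: integral_restrict_UNIV integral_mult_right frac_conv_left_def)
    also have "\<dots> = (if x \<in> {a..b} then \<phi> x * frac_conv_left a \<gamma> \<psi> x else 0)"
      by (simp add: p_def)
    finally show ?thesis .
  qed
  have inner_x: "(\<integral>x. ?h x t \<partial>lborel) = (if t \<in> {a..b} then \<psi> t * frac_conv_right b \<gamma> \<phi> t else 0)" for t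
  proof -
    have "(\<integral>x. ?h x t \<partial>lborel) = integral UNIV (\<lambda>x. ?h x t)"
      by (rule integral_lborel[symmetric, OF it])
    also have "\<dots> = integral UNIV (\<lambda>x. if x \<in> {t..b} then q t * ((x - t) powr (- \<gamma>) * \<phi> x) else 0)"
      by (rule arg_cong[where f = "integral UNIV"]) (auto simp: p_def q_def k_def indicator_def)
    also have "\<dots> = q t * frac_conv_right b \<gamma> \<phi> t"
      by (simp only: integral_restrict_UNIV integral_mult_right frac_conv_right_def)
    also have "\<dots> = (if t \<in> {a..b} then \<psi> t * frac_conv_right b \<gamma> \<phi> t else 0)"
      by (simp add: q_def)
    finally show ?thesis .
  qed
  have "integral {a..b} (\<lambda>x. \<phi> x * frac_conv_left a \<gamma> \<psi> x) = integral UNIV (\<lambda>x. \<integral>t. ?h x t \<partial>lborel)"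
    unfolding inner_t integral_restrict_UNIV ..
  also have "\<dots> = (\<integral>x. (\<integral>t. ?h x t \<partial>lborel) \<partial>lborel)"
    by (rule integral_lborel[OF lborel_pair.integrable_fst[OF int]])
  also have "\<dots> = (\<integral>t. (\<integral>x. ?h x t \<partial>lborel) \<partial>lborel)"
    by (rule lborel_pair.Fubini_integral[OF int, symmetric])
  also have "\<dots> = integral UNIV (\<lambda>t. \<integral>x. ?h x t \<partial>lborel)"
    by (rule integral_lborel[OF lborel_pair.integrable_snd[OF int], symmetric])
  also have "\<dots> = integral {a..b} (\<lambda>t. \<psi> t * frac_conv_right b \<gamma> \<phi> t)"
    unfolding inner_x integral_restrict_UNIV ..
  finally show ?thesis .
qed

text \<open>Away from \<open>b\<close> the convolution is differentiable. At \<open>b\<close> it is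
  an integral over one point, hence 0, and the reflected estimate
  \<open>frac_conv_left_tendsto_0\<close> gives the same limit.\<close>

lemma frac_conv_right_continuous:
  assumes "a < b" "0 < \<gamma>" "\<gamma> < 1" "continuous_on {a..b} \<phi>" "has_cont_RL_right a b \<gamma> \<phi>"
  shows "continuous_on {a..b} (frac_conv_right b \<gamma> \<phi>)"
  unfolding continuous_on_def
proof
  fix x assume x: "x \<in> {a..b}"
  show "(frac_conv_right b \<gamma> \<phi> \<longlongrightarrow> frac_conv_right b \<gamma> \<phi> x) (at x within {a..b})"
  proof (cases "x = b")
    case False
    then have "x \<in> {a..<b}" using x by auto
    from DERIV_continuous[OF has_cont_RL_rightD[OF assms(3,5) this]] show ?thesis
      by (simp add: continuous_within)
  next
    case True
    have eq: "frac_conv_right b \<gamma> \<phi> = (\<lambda>x. frac_conv_left (- b) \<gamma> (\<lambda>t. \<phi> (- t)) (- x))"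
      by (rule ext) (rule frac_conv_right_eq_left_reflect)
    have "continuous_on {- b..- a} (\<lambda>t. \<phi> (- t))"
      by (rule continuous_on_compose2[OF assms(4)]) (auto intro!: continuous_intros)
    then have "(frac_conv_left (- b) \<gamma> (\<lambda>t. \<phi> (- t)) \<longlongrightarrow> 0) (at (- b) within {- b..- a})"
      by (rule frac_conv_left_tendsto_0[OF assms(2,3), rotated]) (use assms(1) in simp)
    moreover have "filterlim uminus (at (- b) within {- b..- a}) (at b within {a..b})"
      unfolding filterlim_at
      by (intro conjI tendsto_minus tendsto_ident_at) (simp add: eventually_at_filter)
    ultimately have "(frac_conv_right b \<gamma> \<phi> \<longlongrightarrow> 0) (at b within {a..b})"
      unfolding eq by (rule filterlim_compose)
    then show ?thesis using True by (simp add: frac_conv_right_def)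
  qed
qed

text \<open>The fractional derivative of \<eta> is a convolution of \<eta>'; Fubini moves the kernel
  to \<phi>, and classical integration by parts moves the derivative onto the convolution of \<phi>,
  where it is \<open>- Gamma (1 - \<gamma>)\<close> times \<open>RL_right\<close>.\<close>

lemma RL_left_by_parts:
  assumes "a < b" "0 < \<gamma>" "\<gamma> < 1" "C1_test a b \<eta> \<eta>'"
    and "continuous_on {a..b} \<phi>" "has_cont_RL_right a b \<gamma> \<phi>"
  shows "integral {a..b} (\<lambda>x. \<phi> x * RL_left a b \<gamma> \<eta> x) = integral {a..b} (\<lambda>x. RL_right a b \<gamma> \<phi> x * \<eta> x)"
proof -
  let ?G = "Gamma (1 - \<gamma>)" and ?K = "frac_conv_right b \<gamma> \<phi>"
  have G: "?G \<noteq> 0" using assms Gamma_real_pos[of "1 - \<gamma>"] by linarith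
  note K = frac_conv_right_continuous[OF assms(1-3,5,6)]
  have "((\<lambda>x. ?K x * \<eta>' x) has_integral integral {a..b} (\<lambda>x. ?K x * \<eta>' x)) {a..b}"
    by (intro integrable_integral integrable_continuous_real continuous_intros K
        C1_test_deriv_continuous[OF assms(4)])
  \<comment> \<open>The boundary terms are 0 and are written out to match the integration by parts
    rule.\<close>
  then have ip: "((\<lambda>x. ?K x * \<eta>' x) has_integral
      ?K b * \<eta> b - ?K a * \<eta> a - (- integral {a..b} (\<lambda>x. ?K x * \<eta>' x))) {a..b}"
    using assms(4) by (simp add: C1_test_def)
  \<comment> \<open>The interior form of the rule fits: \<open>?K\<close> is continuous up to
    \<open>b\<close>, but \<open>has_cont_RL_right\<close> does not make it differentiable at
    \<open>b\<close>.\<close>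
  have "((\<lambda>x. (- ?G * RL_right a b \<gamma> \<phi> x) * \<eta> x) has_integral - integral {a..b} (\<lambda>x. ?K x * \<eta>' x)) {a..b}"
  proof (rule integration_by_parts_interior[OF bounded_bilinear_mult _ K _ _ _ ip])
    show "continuous_on {a..b} \<eta>" by (rule C1_test_continuous[OF assms(4)])
    show "(\<eta> has_vector_derivative \<eta>' x) (at x)" for x
      using assms(4) by (simp add: C1_test_def has_real_derivative_iff_has_vector_derivative)
    show "(?K has_vector_derivative - ?G * RL_right a b \<gamma> \<phi> x) (at x)" if "x \<in> {a<..<b}" for x
      using has_cont_RL_rightD[OF assms(3,6), of x] that
      by (auto simp: has_real_derivative_iff_has_vector_derivative at_within_Icc_at)
  qed (use assms(1) in simp)
  then have "((\<lambda>x. - 1 / ?G * ((- ?G * RL_right a b \<gamma> \<phi> x) * \<eta> x)) has_integral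
      - 1 / ?G * (- integral {a..b} (\<lambda>x. ?K x * \<eta>' x))) {a..b}"
    by (rule has_integral_mult_right)
  moreover have "- 1 / ?G * ((- ?G * u) * v) = u * v" "- 1 / ?G * (- u) = 1 / ?G * u" for u v :: real
    using G by simp_all
  ultimately
  have RL: "integral {a..b} (\<lambda>x. RL_right a b \<gamma> \<phi> x * \<eta> x) = 1 / ?G * integral {a..b} (\<lambda>x. ?K x * \<eta>' x)"
    by (simp only: integral_unique)
  have "integral {a..b} (\<lambda>x. \<phi> x * RL_left a b \<gamma> \<eta> x) =
      integral {a..b} (\<lambda>x. 1 / ?G * (\<phi> x * frac_conv_left a \<gamma> \<eta>' x))"
    by (rule integral_cong) (use RL_left_test(2)[OF assms(1-4)] in auto)
  also have "\<dots> = 1 / ?G * integral {a..b} (\<lambda>t. \<eta>' t * ?K t)"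
    by (simp only: integral_mult_right
        frac_conv_fubini[OF assms(2,3,5) C1_test_deriv_continuous[OF assms(4)]])
  finally show ?thesis unfolding RL by (simp add: mult.commute)
qed

lemma RL_right_by_parts:
  assumes "a < b" "0 < \<gamma>" "\<gamma> < 1" "C1_test a b \<eta> \<eta>'"
    and "continuous_on {a..b} \<phi>" "has_cont_RL_left a b \<gamma> \<phi>"
  shows "integral {a..b} (\<lambda>x. \<phi> x * RL_right a b \<gamma> \<eta> x) = integral {a..b} (\<lambda>x. RL_left a b \<gamma> \<phi> x * \<eta> x)"
proof -
  note T = C1_test_reflect[OF assms(4)]
  have cont: "continuous_on {- b..- a} (\<lambda>t. \<phi> (- t))"
    by (rule continuous_on_compose2[OF assms(5)]) (auto intro!: continuous_intros)
  have L: "has_cont_RL_left (- b) (- a) \<gamma> (\<lambda>t. \<eta> (- t))"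
    using RL_left_test(1) T assms by auto
  have R: "RL_right a b \<gamma> \<eta> (- x) = RL_left (- b) (- a) \<gamma> (\<lambda>t. \<eta> (- t)) x" if "x \<in> {- b..- a}" for x
    using RL_left_reflect(2)[OF _ assms(3) L that] assms(1) by simp
  have "integral {a..b} (\<lambda>x. \<phi> x * RL_right a b \<gamma> \<eta> x) =
      integral {- b..- a} (\<lambda>x. \<phi> (- x) * RL_right a b \<gamma> \<eta> (- x))"
    by (rule Henstock_Kurzweil_Integration.integral_reflect_real[symmetric])
  also have "\<dots> = integral {- b..- a} (\<lambda>x. \<phi> (- x) * RL_left (- b) (- a) \<gamma> (\<lambda>t. \<eta> (- t)) x)"
    by (rule integral_cong) (use R in auto)
  also have "\<dots> = integral {- b..- a} (\<lambda>x. RL_right (- b) (- a) \<gamma> (\<lambda>t. \<phi> (- t)) x * \<eta> (- x))"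
    by (rule RL_left_by_parts[OF _ assms(2,3) T cont RL_left_reflect(1)]) (use assms in auto)
  also have "\<dots> = integral {- b..- a} (\<lambda>x. RL_left a b \<gamma> \<phi> (- x) * \<eta> (- x))"
  proof (rule integral_cong)
    fix x assume "x \<in> {- b..- a}"
    then show "RL_right (- b) (- a) \<gamma> (\<lambda>t. \<phi> (- t)) x * \<eta> (- x) = RL_left a b \<gamma> \<phi> (- x) * \<eta> (- x)"
      using RL_left_reflect(2)[OF assms(1,3,6), of "- x"] by auto
  qed
  also have "\<dots> = integral {a..b} (\<lambda>x. RL_left a b \<gamma> \<phi> x * \<eta> x)"
    by (rule Henstock_Kurzweil_Integration.integral_reflect_real)
  finally show ?thesis .
qed

section \<open>First variation of a functional\<close>

lemma dom4_iff: "(x, w) \<in> dom4 a b \<longleftrightarrow> x \<in> {a..b}"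
  by (simp add: dom4_def)

text \<open>The gradient in the directions in which a variation moves a point, at fixed
  \<open>x\<close>. It is a bounded linear form so that its continuity in the base point can be
  stated in the operator norm, as the rules for partial derivatives and for differentiation under
  the integral require.\<close>

definition grad_yuv :: "real \<Rightarrow> real \<Rightarrow> (pt \<Rightarrow> real) \<Rightarrow> pt \<Rightarrow> (real \<times> real \<times> real) \<Rightarrow>\<^sub>L real" where
  "grad_yuv a b f p =
    partial_deriv (dom4 a b) dir_y f p *\<^sub>R fst_blinfun +
    (partial_deriv (dom4 a b) dir_u f p *\<^sub>R (fst_blinfun o\<^sub>L snd_blinfun) +
     partial_deriv (dom4 a b) dir_v f p *\<^sub>R (snd_blinfun o\<^sub>L snd_blinfun))"

lemma grad_yuv_apply:
  "blinfun_apply (grad_yuv a b f p) (h, k, m) =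
    partial_deriv (dom4 a b) dir_y f p * h + partial_deriv (dom4 a b) dir_u f p * k +
    partial_deriv (dom4 a b) dir_v f p * m"
  by (simp add: grad_yuv_def blinfun.bilinear_simps)

lemma Basis_pt_members:
  "(1, 0, 0, 0) \<in> (Basis :: pt set)" "dir_y \<in> Basis" "dir_u \<in> Basis" "dir_v \<in> Basis"
  by (auto simp: dir_y_def dir_u_def dir_v_def Basis_prod_def zero_prod_def[symmetric])

lemma partial_deriv_works:
  assumes "C1_partials S f" "e \<in> Basis" "p \<in> S"
  shows "((\<lambda>t. f (p + t *\<^sub>R e)) has_real_derivative partial_deriv S e f p)
    (at 0 within {t. p + t *\<^sub>R e \<in> S})"
  using assms by (auto simp: C1_partials_def partial_deriv_def vector_derivative_works
      has_real_derivative_iff_has_vector_derivative)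

lemma partial_deriv_continuous:
  "C1_partials S f \<Longrightarrow> e \<in> Basis \<Longrightarrow> continuous_on S (partial_deriv S e f)"
  by (auto simp: C1_partials_def)

lemma grad_yuv_continuous:
  assumes "C1_partials (dom4 a b) f"
  shows "continuous_on (dom4 a b) (grad_yuv a b f)"
  unfolding grad_yuv_def
  by (intro continuous_intros partial_deriv_continuous[OF assms] Basis_pt_members)

lemma has_real_derivative_partial_yuv:
  assumes "C1_partials (dom4 a b) f" "x \<in> {a..b}"
  shows "((\<lambda>s. f (x, s, u, v)) has_real_derivative partial_deriv (dom4 a b) dir_y f (x, y, u, v)) (at y)"
    and "((\<lambda>s. f (x, y, s, v)) has_real_derivative partial_deriv (dom4 a b) dir_u f (x, y, u, v)) (at u)"
    and "((\<lambda>s. f (x, y, u, s)) has_real_derivative partial_deriv (dom4 a b) dir_v f (x, y, u, v)) (at v)"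
proof -
  note D = partial_deriv_works[OF assms(1), of _ "(x, y, u, v)"]
  show "((\<lambda>s. f (x, s, u, v)) has_real_derivative partial_deriv (dom4 a b) dir_y f (x, y, u, v)) (at y)"
    using D[OF Basis_pt_members(2)] DERIV_shift[of "\<lambda>s. f (x, s, u, v)" _ 0 y] assms(2)
    by (simp add: dom4_iff dir_y_def add.commute)
  show "((\<lambda>s. f (x, y, s, v)) has_real_derivative partial_deriv (dom4 a b) dir_u f (x, y, u, v)) (at u)"
    using D[OF Basis_pt_members(3)] DERIV_shift[of "\<lambda>s. f (x, y, s, v)" _ 0 u] assms(2)
    by (simp add: dom4_iff dir_u_def add.commute)
  show "((\<lambda>s. f (x, y, u, s)) has_real_derivative partial_deriv (dom4 a b) dir_v f (x, y, u, v)) (at v)"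
    using D[OF Basis_pt_members(4)] DERIV_shift[of "\<lambda>s. f (x, y, u, s)" _ 0 v] assms(2)
    by (simp add: dom4_iff dir_v_def add.commute)
qed

lemma has_real_derivative_partial_x:
  assumes "C1_partials (dom4 a b) f" "x \<in> {a..b}"
  shows "((\<lambda>s. f (s, w)) has_real_derivative partial_deriv (dom4 a b) (1, 0, 0, 0) f (x, w)) (at x within {a..b})"
proof -
  have im: "(+) x ` {t. (x + t, w) \<in> dom4 a b} = {a..b}"
    by (auto simp: dom4_iff image_iff intro!: exI[of _ "_ - x"])
  have "((\<lambda>t. f (x + t, w)) has_real_derivative partial_deriv (dom4 a b) (1, 0, 0, 0) f (x, w))
      (at 0 within {t. (x + t, w) \<in> dom4 a b})"
    using partial_deriv_works[OF assms(1) Basis_pt_members(1), of "(x, w)"] assms(2)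
    by (cases w) (simp add: dom4_iff)
  then show ?thesis
    using DERIV_at_within_shift[of "\<lambda>s. f (s, w)" _ x 0 "{t. (x + t, w) \<in> dom4 a b}"] im by simp
qed

text \<open>Continuous partial derivatives give a total derivative. The rule joins two blocks of
  variables at a time and is therefore applied twice: to \<open>u\<close> and \<open>v\<close>, then
  to \<open>y\<close> and that pair.\<close>

lemma has_derivative_yuv:
  assumes f: "C1_partials (dom4 a b) f" and x: "x \<in> {a..b}"
  shows "((\<lambda>w. f (x, w)) has_derivative blinfun_apply (grad_yuv a b f (x, w))) (at w)"
proof -
  let ?pd = "\<lambda>e. partial_deriv (dom4 a b) e f"
  have cont: "continuous (at z within X) (\<lambda>z. ?pd e (h z))"
    if "e \<in> Basis" "continuous_on UNIV h" "\<And>z. h z \<in> dom4 a b" for e X and h :: "'z::real_normed_vector \<Rightarrow> pt" and z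
    using continuous_on_compose2[OF partial_deriv_continuous[OF f that(1)] that(2)] that(3)
    by (metis UNIV_I continuous_on_eq_continuous_within continuous_within_subset image_subset_iff subset_UNIV)
  have uv: "((\<lambda>(u, v). f (x, y, u, v)) has_derivative
      blinfun_apply (?pd dir_u (x, y, q) *\<^sub>R fst_blinfun + ?pd dir_v (x, y, q) *\<^sub>R snd_blinfun)) (at q)"
    for y and q :: "real \<times> real"
  proof -
    obtain u v where q: "q = (u, v)" by force
    have "((\<lambda>(u, v). f (x, y, u, v)) has_derivative
        (\<lambda>(tu, tv). ?pd dir_u (x, y, u, v) * tu + blinfun_apply (?pd dir_v (x, y, u, v) *\<^sub>R id_blinfun) tv))
        (at (u, v) within UNIV \<times> UNIV)"
    proof (rule has_derivative_partialsI[where fy = "\<lambda>u v. ?pd dir_v (x, y, u, v) *\<^sub>R id_blinfun"])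
      show "((\<lambda>u. f (x, y, u, v)) has_derivative (*) (?pd dir_u (x, y, u, v))) (at u within UNIV)"
        using has_real_derivative_partial_yuv(2)[OF f x] by (simp add: has_field_derivative_def)
      show "((\<lambda>v. f (x, y, u, v)) has_derivative blinfun_apply (?pd dir_v (x, y, u, v) *\<^sub>R id_blinfun))
          (at v within UNIV)" for u v
        using has_real_derivative_partial_yuv(3)[OF f x, of y u v]
        by (simp add: has_field_derivative_def id_blinfun.rep_eq scaleR_blinfun.rep_eq)
      show "continuous (at (u, v) within UNIV \<times> UNIV) (\<lambda>(u, v). ?pd dir_v (x, y, u, v) *\<^sub>R id_blinfun)"
        unfolding split_beta
        by (intro continuous_intros cont Basis_pt_members) (use x in \<open>auto simp: dom4_iff intro!: continuous_intros\<close>)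
    qed auto
    then have "((\<lambda>(u, v). f (x, y, u, v)) has_derivative
        (\<lambda>(tu, tv). ?pd dir_u (x, y, u, v) * tu + blinfun_apply (?pd dir_v (x, y, u, v) *\<^sub>R id_blinfun) tv))
        (at q)"
      by (simp only: UNIV_Times_UNIV q)
    then show ?thesis
      by (rule has_derivative_eq_rhs) (auto simp: q blinfun.bilinear_simps)
  qed
  have eta: "(\<lambda>(u, v). f (x, y, u, v)) = (\<lambda>q. f (x, y, q))" for y by auto
  obtain y u v where w: "w = (y, u, v)" by (metis prod_cases3)
  let ?G = "\<lambda>y q. ?pd dir_u (x, y, q) *\<^sub>R fst_blinfun + ?pd dir_v (x, y, q) *\<^sub>R snd_blinfun"
  have "((\<lambda>(y, q). f (x, y, q)) has_derivative
      (\<lambda>(ty, tq). ?pd dir_y (x, y, u, v) * ty + blinfun_apply (?G y (u, v)) tq))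
      (at (y, (u, v)) within UNIV \<times> UNIV)"
  proof (rule has_derivative_partialsI[where fy = ?G])
    show "((\<lambda>y. f (x, y, u, v)) has_derivative (*) (?pd dir_y (x, y, u, v))) (at y within UNIV)"
      using has_real_derivative_partial_yuv(1)[OF f x] by (simp add: has_field_derivative_def)
    show "((\<lambda>q. f (x, y, q)) has_derivative blinfun_apply (?G y q)) (at q within UNIV)" for y q
      using uv[of y q] unfolding eta by simp
    show "continuous (at (y, u, v) within UNIV \<times> UNIV) (\<lambda>(y, q). ?G y q)"
      unfolding split_beta
      by (intro continuous_intros cont Basis_pt_members) (use x in \<open>auto simp: dom4_iff intro!: continuous_intros\<close>)
  qed auto
  then have "((\<lambda>w. f (x, w)) has_derivative
      (\<lambda>(ty, tq). ?pd dir_y (x, y, u, v) * ty + blinfun_apply (?G y (u, v)) tq)) (at w)"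
    unfolding w UNIV_Times_UNIV by (rule has_derivative_transform[rotated 2]) auto
  then show ?thesis
    by (rule has_derivative_eq_rhs) (auto simp: w grad_yuv_apply blinfun.bilinear_simps)
qed

text \<open>\<open>C1_partials\<close> asks for continuity of the partial derivatives, not of
  \<open>f\<close>. Joining \<open>x\<close> to the block of the other three variables makes
  \<open>f\<close> totally differentiable, hence continuous.\<close>

lemma C1_partials_continuous:
  assumes f: "C1_partials (dom4 a b) f"
  shows "continuous_on (dom4 a b) f"
  unfolding continuous_on_eq_continuous_within
proof
  fix p assume p: "p \<in> dom4 a b"
  obtain x w where xw: "p = (x, w)" by (cases p)
  then have x: "x \<in> {a..b}" using p by (simp add: dom4_iff)
  have "((\<lambda>(x, w). f (x, w)) has_derivative
      (\<lambda>(tx, tw). partial_deriv (dom4 a b) (1, 0, 0, 0) f (x, w) * tx + blinfun_apply (grad_yuv a b f (x, w)) tw))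
      (at (x, w) within {a..b} \<times> UNIV)"
  proof (rule has_derivative_partialsI[where fy = "\<lambda>x w. grad_yuv a b f (x, w)"])
    show "((\<lambda>x. f (x, w)) has_derivative (*) (partial_deriv (dom4 a b) (1, 0, 0, 0) f (x, w))) (at x within {a..b})"
      using has_real_derivative_partial_x[OF f x] by (simp add: has_field_derivative_def)
    show "continuous (at (x, w) within {a..b} \<times> UNIV) (\<lambda>(x, w). grad_yuv a b f (x, w))"
      using grad_yuv_continuous[OF f] x
      by (cases w) (simp add: continuous_on_eq_continuous_within dom4_def split_beta)
  qed (use has_derivative_yuv[OF f] in auto)
  from has_derivative_continuous[OF this] show "continuous (at p within dom4 a b) f"
    by (simp add: xw dom4_def split_beta)
qed

text \<open>Fractional derivatives are linear in the varied function, so they enter only through the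
  continuous curves \<open>w0\<close>, \<open>w1\<close>, \<open>w2\<close>. The integrand is then
  C1 in the parameters, and differentiation under the integral sign applies.\<close>

lemma first_variation:
  fixes a b :: real and w0 w1 w2 :: "real \<Rightarrow> real \<times> real \<times> real"
  defines "\<Phi> \<equiv> \<lambda>f s. integral {a..b} (\<lambda>x. f (x, w0 x + fst s *\<^sub>R w1 x + snd s *\<^sub>R w2 x))"
  assumes f: "C1_partials (dom4 a b) f"
    and w: "continuous_on {a..b} w0" "continuous_on {a..b} w1" "continuous_on {a..b} w2"
  shows "continuous_on UNIV (\<Phi> f)"
    and "(\<Phi> f has_derivative (\<lambda>s.
        fst s * integral {a..b} (\<lambda>x. blinfun_apply (grad_yuv a b f (x, w0 x)) (w1 x)) +
        snd s * integral {a..b} (\<lambda>x. blinfun_apply (grad_yuv a b f (x, w0 x)) (w2 x)))) (at 0)"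
proof -
  let ?w = "\<lambda>s x. w0 x + fst s *\<^sub>R w1 x + snd s *\<^sub>R w2 x"
  \<comment> \<open>Linear forms on the parameter plane, as the Leibniz rule requires;
    \<open>D_apply\<close> later evaluates their integral by integrating the values.\<close>
  let ?D = "\<lambda>s x. blinfun_apply (grad_yuv a b f (x, ?w s x)) (w1 x) *\<^sub>R fst_blinfun +
      blinfun_apply (grad_yuv a b f (x, ?w s x)) (w2 x) *\<^sub>R snd_blinfun :: (real \<times> real) \<Rightarrow>\<^sub>L real"
  note wS = w[THEN continuous_on_compose2]
  have contp: "continuous_on (UNIV \<times> {a..b}) (\<lambda>z :: (real \<times> real) \<times> real. (snd z, ?w (fst z) (snd z)))"
    by (intro continuous_intros wS) auto
  have contf: "continuous_on (UNIV \<times> cbox a b) (\<lambda>(s, x). f (x, ?w s x))"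
    using continuous_on_compose2[OF C1_partials_continuous[OF f] contp]
    by (auto simp: split_beta dom4_iff image_subset_iff)
  have contg: "continuous_on (UNIV \<times> {a..b}) (\<lambda>z. grad_yuv a b f (snd z, ?w (fst z) (snd z)))"
    using continuous_on_compose2[OF grad_yuv_continuous[OF f] contp]
    by (auto simp: dom4_iff image_subset_iff)
  have contD: "continuous_on (UNIV \<times> cbox a b) (\<lambda>(s, x). ?D s x)"
    unfolding split_beta cbox_interval
    by (intro continuous_intros contg wS) auto
  show "continuous_on UNIV (\<Phi> f)"
    using integral_continuous_on_param[OF contf] by (simp add: \<Phi>_def)
  have deriv: "((\<lambda>s. integral (cbox a b) (\<lambda>x. f (x, ?w s x))) has_derivative
      blinfun_apply (integral (cbox a b) (?D 0))) (at 0 within UNIV)"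
  proof (rule leibniz_rule[OF _ _ contD])
    fix s :: "real \<times> real" and x :: real assume x: "x \<in> cbox a b"
    have "((\<lambda>s. f (x, ?w s x)) has_derivative
        (\<lambda>h. blinfun_apply (grad_yuv a b f (x, ?w s x)) (fst h *\<^sub>R w1 x + snd h *\<^sub>R w2 x))) (at s)"
      by (rule has_derivative_compose[of "\<lambda>s. ?w s x", OF _ has_derivative_yuv[OF f]])
        (use x in \<open>auto intro!: derivative_eq_intros\<close>)
    then show "((\<lambda>s. f (x, ?w s x)) has_derivative blinfun_apply (?D s x)) (at s within UNIV)"
      by (rule has_derivative_eq_rhs) (auto simp: blinfun.bilinear_simps)
  next
    show "(\<lambda>x. f (x, ?w s x)) integrable_on cbox a b" for s
      using continuous_on_compose2[OF contf, of "cbox a b" "\<lambda>x. (s, x)"]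
      by (intro integrable_continuous) (simp add: image_subset_iff continuous_on_Pair)
  qed auto
  have D_apply: "blinfun_apply (integral (cbox a b) (?D 0)) s =
      fst s * integral {a..b} (\<lambda>x. blinfun_apply (grad_yuv a b f (x, w0 x)) (w1 x)) +
      snd s * integral {a..b} (\<lambda>x. blinfun_apply (grad_yuv a b f (x, w0 x)) (w2 x))" for s
  proof -
    have cg: "continuous_on {a..b} (\<lambda>x. grad_yuv a b f (x, w0 x))"
      by (rule continuous_on_compose2[OF grad_yuv_continuous[OF f]])
        (auto simp: dom4_iff intro!: continuous_intros w)
    have D: "?D 0 integrable_on cbox a b"
      unfolding cbox_interval fst_zero snd_zero scaleR_zero_left add_0_right
      by (intro integrable_continuous_real continuous_intros cg w)
    have i: "(\<lambda>x. blinfun_apply (grad_yuv a b f (x, w0 x)) (w1 x)) integrable_on {a..b}"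
      "(\<lambda>x. blinfun_apply (grad_yuv a b f (x, w0 x)) (w2 x)) integrable_on {a..b}"
      by (intro integrable_continuous_real continuous_intros cg w)+
    have "blinfun_apply (integral (cbox a b) (?D 0)) s = integral {a..b} (\<lambda>x.
        fst s * blinfun_apply (grad_yuv a b f (x, w0 x)) (w1 x) +
        snd s * blinfun_apply (grad_yuv a b f (x, w0 x)) (w2 x))"
      unfolding blinfun_apply_integral[OF D] by (simp add: blinfun.bilinear_simps mult.commute)
    also have "\<dots> = fst s * integral {a..b} (\<lambda>x. blinfun_apply (grad_yuv a b f (x, w0 x)) (w1 x)) +
        snd s * integral {a..b} (\<lambda>x. blinfun_apply (grad_yuv a b f (x, w0 x)) (w2 x))"
      by (subst integral_add) (auto intro!: integrable_on_mult_right i)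
    finally show ?thesis .
  qed
  show "(\<Phi> f has_derivative (\<lambda>s.
        fst s * integral {a..b} (\<lambda>x. blinfun_apply (grad_yuv a b f (x, w0 x)) (w1 x)) +
        snd s * integral {a..b} (\<lambda>x. blinfun_apply (grad_yuv a b f (x, w0 x)) (w2 x)))) (at 0)"
    unfolding \<Phi>_def using has_derivative_eq_rhs[OF deriv ext[OF D_apply]] unfolding cbox_interval .
qed

section \<open>A multiplier rule with two parameters\<close>

text \<open>When the derivative at 0 is invertible, the image of every small ball contains a ball
  around \<open>(P 0, Q 0)\<close>. Moving the first coordinate alone keeps \<open>Q\<close> fixed
  and changes \<open>P\<close> in either direction; one direction refutes minima, the other
  maxima.\<close>

lemma lagrange_two_parameters:
  fixes P Q :: "real \<times> real \<Rightarrow> real"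
  assumes cont: "continuous_on UNIV P" "continuous_on UNIV Q"
    and der: "(P has_derivative (\<lambda>s. fst s * A1 + snd s * A2)) (at 0)"
      "(Q has_derivative (\<lambda>s. fst s * B1 + snd s * B2)) (at 0)"
    and det: "A1 * B2 \<noteq> A2 * B1" and r: "r > 0"
  shows "\<exists>s. norm s < r \<and> Q s = Q 0 \<and> P s < P 0"
    and "\<exists>s. norm s < r \<and> Q s = Q 0 \<and> P s > P 0"
proof -
  let ?d = "A1 * B2 - A2 * B1"
  let ?F = "\<lambda>s. (P s, Q s)"
  \<comment> \<open>Cramer's rule: the inverse of the matrix with rows \<open>(A1, A2)\<close> and
    \<open>(B1, B2)\<close>.\<close>
  let ?g = "\<lambda>z. ((B2 * fst z - A2 * snd z) / ?d, (A1 * snd z - B1 * fst z) / ?d) :: real \<times> real"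
  have d: "?d \<noteq> 0" using det by simp
  have "?F 0 \<in> interior (?F ` ball 0 r)"
  proof (rule sussmann_open_mapping[OF open_UNIV])
    show "continuous_on UNIV ?F" by (intro continuous_intros cont)
    show "(?F has_derivative (\<lambda>s. (fst s * A1 + snd s * A2, fst s * B1 + snd s * B2))) (at 0)"
      by (intro has_derivative_Pair der)
    have "linear ?g"
      by (rule linearI) (simp_all add: diff_divide_distrib add_divide_distrib algebra_simps)
    then show "bounded_linear ?g"
      by (simp only: linear_conv_bounded_linear)
    show "(\<lambda>s. (fst s * A1 + snd s * A2, fst s * B1 + snd s * B2)) \<circ> ?g = id"
    proof (rule ext)
      fix z :: "real \<times> real"
      obtain p q where z: "z = (p, q)" by force
      have "(B2 * p - A2 * q) / ?d * A1 + (A1 * q - B1 * p) / ?d * A2 = p * ?d / ?d"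
        unfolding times_divide_eq_left add_divide_distrib[symmetric] by (simp add: algebra_simps)
      moreover have "(B2 * p - A2 * q) / ?d * B1 + (A1 * q - B1 * p) / ?d * B2 = q * ?d / ?d"
        unfolding times_divide_eq_left add_divide_distrib[symmetric] by (simp add: algebra_simps)
      ultimately show "((\<lambda>s. (fst s * A1 + snd s * A2, fst s * B1 + snd s * B2)) \<circ> ?g) z = id z"
        using d by (simp add: z)
    qed
  qed (use r in auto)
  then obtain e where e: "e > 0" "ball (?F 0) e \<subseteq> ?F ` ball 0 r"
    by (auto simp: mem_interior)
  have "(P 0 - e / 2, Q 0) \<in> ball (?F 0) e" "(P 0 + e / 2, Q 0) \<in> ball (?F 0) e"
    using e(1) by (simp_all add: dist_Pair_Pair dist_real_def)
  then obtain s t where st: "s \<in> ball 0 r" "(P 0 - e / 2, Q 0) = ?F s"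
    "t \<in> ball 0 r" "(P 0 + e / 2, Q 0) = ?F t"
    using e(2) by blast
  have "norm s < r \<and> Q s = Q 0 \<and> P s < P 0" "norm t < r \<and> Q t = Q 0 \<and> P t > P 0"
    using st e(1) by simp_all
  then show "\<exists>s. norm s < r \<and> Q s = Q 0 \<and> P s < P 0" "\<exists>s. norm s < r \<and> Q s = Q 0 \<and> P s > P 0"
    by blast+
qed

section \<open>The fundamental lemma\<close>

lemma has_real_derivative_positive_part_square:
  "((\<lambda>t. (max 0 t)\<^sup>2) has_real_derivative 2 * max 0 t) (at (t::real))"
proof (cases t "0::real" rule: linorder_cases)
  case less
  have "((\<lambda>t. 0) has_real_derivative 0) (at t)" by simp
  from has_field_derivative_transform_within_open[OF this, of "{..<0}" "\<lambda>t. (max 0 t)\<^sup>2"] less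
  show ?thesis by (auto simp: max_def)
next
  case greater
  have "((\<lambda>t. t\<^sup>2) has_real_derivative 2 * t) (at t)" by (auto intro!: derivative_eq_intros)
  from has_field_derivative_transform_within_open[OF this, of "{0<..}" "\<lambda>t. (max 0 t)\<^sup>2"] greater
  show ?thesis by (auto simp: max_def)
next
  case equal
  have "((\<lambda>h::real. (max 0 h)\<^sup>2 / h) \<longlongrightarrow> 0) (at 0)"
  proof (rule Lim_null_comparison)
    show "((\<lambda>h::real. \<bar>h\<bar>) \<longlongrightarrow> 0) (at 0)"
      by (rule tendsto_rabs_zero) (rule tendsto_ident_at)
    show "\<forall>\<^sub>F h in at 0. norm ((max 0 h)\<^sup>2 / h) \<le> \<bar>h::real\<bar>"
      by (rule always_eventually) (auto simp: max_def power2_eq_square)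
  qed
  then show ?thesis using equal by (simp add: DERIV_def)
qed

text \<open>The parabola \<open>(t - c) * (d - t)\<close> is positive exactly between
  \<open>c\<close> and \<open>d\<close>; squaring its positive part smooths the kinks at both
  ends.\<close>

lemma C1_test_bump:
  assumes "a \<le> c" "c \<le> d" "d \<le> b"
  shows "C1_test a b (\<lambda>t. (max 0 ((t - c) * (d - t)))\<^sup>2) (\<lambda>t. 2 * max 0 ((t - c) * (d - t)) * (c + d - 2 * t))"
  unfolding C1_test_def
proof (intro conjI allI impI)
  show "((\<lambda>t. (max 0 ((t - c) * (d - t)))\<^sup>2) has_real_derivative
      2 * max 0 ((t - c) * (d - t)) * (c + d - 2 * t)) (at t)" for t
    by (rule DERIV_chain2[OF has_real_derivative_positive_part_square])
      (auto intro!: derivative_eq_intros simp: algebra_simps)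
  show "continuous_on UNIV (\<lambda>t. 2 * max 0 ((t - c) * (d - t)) * (c + d - 2 * t))"
    by (intro continuous_intros)
  fix t assume "t \<le> a \<or> b \<le> t"
  then have "(t - c) * (d - t) \<le> 0"
    using assms by (auto intro: mult_nonpos_nonneg mult_nonneg_nonpos)
  then show "(max 0 ((t - c) * (d - t)))\<^sup>2 = 0" "2 * max 0 ((t - c) * (d - t)) * (c + d - 2 * t) = 0"
    by (simp_all add: max_def)
qed

lemma fundamental_lemma_C1_test:
  fixes E :: "real \<Rightarrow> real"
  assumes "a < b" and E: "continuous_on {a..b} E"
    and int: "\<And>\<eta> \<eta>'. C1_test a b \<eta> \<eta>' \<Longrightarrow> integral {a..b} (\<lambda>x. E x * \<eta> x) = 0"
    and x0: "x0 \<in> {a..b}"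
  shows "E x0 = 0"
proof (rule ccontr)
  assume nz: "E x0 \<noteq> 0"
  then obtain r where r: "r > 0" "\<And>x. x \<in> {a..b} \<Longrightarrow> dist x x0 < r \<Longrightarrow> dist (E x) (E x0) < \<bar>E x0\<bar>"
    using E[unfolded continuous_on_iff, rule_format, OF x0, of "\<bar>E x0\<bar>"] by auto
  \<comment> \<open>Clipping to \<open>[a,b]\<close> covers the case that \<open>x0\<close> is an
    endpoint; the half radius keeps the closed interval inside the open ball.\<close>
  define c d where "c = max a (x0 - r / 2)" and "d = min b (x0 + r / 2)"
  have cd: "a \<le> c" "c < d" "d \<le> b" using assms r by (auto simp: c_def d_def)
  \<comment> \<open>Multiplying by \<open>E x0\<close> treats both signs at once.\<close>
  have sgn: "0 < E x0 * E x" if "x \<in> {c..d}" for x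
  proof -
    have "dist x x0 < r" "x \<in> {a..b}" using that cd r by (auto simp: c_def d_def dist_real_def)
    then have "\<bar>E x - E x0\<bar> < \<bar>E x0\<bar>" using r(2) by (simp add: dist_real_def)
    then show ?thesis by (cases "E x0 > 0") (auto simp: zero_less_mult_iff abs_if split: if_splits)
  qed
  let ?\<eta> = "\<lambda>t. (max 0 ((t - c) * (d - t)))\<^sup>2"
  have test: "C1_test a b ?\<eta> (\<lambda>t. 2 * max 0 ((t - c) * (d - t)) * (c + d - 2 * t))"
    using cd by (intro C1_test_bump) auto
  have nonneg: "0 \<le> E x0 * E x * ?\<eta> x" for x
  proof (cases "x \<in> {c..d}")
    case True
    then show ?thesis using mult_nonneg_nonneg[OF less_imp_le[OF sgn[OF True]]] by simp
  next
    case False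
    then have "(x - c) * (d - x) \<le> 0"
      using cd by (auto simp: not_le intro: mult_nonpos_nonneg mult_nonneg_nonpos)
    then show ?thesis by (simp add: max_def)
  qed
  have "integral {a..b} (\<lambda>x. E x0 * E x * ?\<eta> x) = E x0 * integral {a..b} (\<lambda>x. E x * ?\<eta> x)"
    by (simp only: mult.assoc integral_mult_right)
  also have "\<dots> = 0" using int[OF test] by simp
  finally have int0: "integral {a..b} (\<lambda>x. E x0 * E x * ?\<eta> x) = 0" .
  have "continuous_on {a..b} (\<lambda>x. E x0 * E x * ?\<eta> x)"
    by (intro continuous_on_mult continuous_on_const E C1_test_continuous[OF test])
  then have zero: "\<forall>x\<in>{a..b}. E x0 * E x * ?\<eta> x = 0"
    using integral_eq_0_iff[of a b "\<lambda>x. E x0 * E x * ?\<eta> x"] assms(1) nonneg int0 by blast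
  \<comment> \<open>At the midpoint the bump is positive, which contradicts the vanishing of the
    integrand.\<close>
  define m where "m = (c + d) / 2"
  have m: "m \<in> {c..d}" "m \<in> {a..b}" "0 < (m - c) * (d - m)" using cd by (auto simp: m_def)
  have "?\<eta> m > 0" by (rule zero_less_power, rule less_le_trans[OF m(3) max.cobounded2])
  then have "0 < E x0 * E m * ?\<eta> m" by (rule mult_pos_pos[OF sgn[OF m(1)]])
  with bspec[OF zero m(2)] show False by linarith
qed

section \<open>The isoperimetric problem\<close>

lemma independent_u:
  assumes "\<not> depends_on (dom4 a b) dir_u f" "x \<in> {a..b}"
  shows "f (x, y, u, v) = f (x, y, u', v)"
proof -
  have mem: "(x, y, u', v) \<in> dom4 a b" "(x, y, u', v) + (u - u') *\<^sub>R dir_u \<in> dom4 a b"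
    using assms(2) by (simp_all add: dom4_iff dir_u_def)
  have "f ((x, y, u', v) + (u - u') *\<^sub>R dir_u) = f (x, y, u', v)"
    using assms(1) mem unfolding depends_on_def by blast
  then show ?thesis by (simp add: dir_u_def)
qed

lemma independent_v:
  assumes "\<not> depends_on (dom4 a b) dir_v f" "x \<in> {a..b}"
  shows "f (x, y, u, v) = f (x, y, u, v')"
proof -
  have mem: "(x, y, u, v') \<in> dom4 a b" "(x, y, u, v') + (v - v') *\<^sub>R dir_v \<in> dom4 a b"
    using assms(2) by (simp_all add: dom4_iff dir_v_def)
  have "f ((x, y, u, v') + (v - v') *\<^sub>R dir_v) = f (x, y, u, v')"
    using assms(1) mem unfolding depends_on_def by blast
  then show ?thesis by (simp add: dir_v_def)
qed

lemma partial_deriv_dom4: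
  assumes "x \<in> {a..b}"
  shows "partial_deriv (dom4 a b) (0, w) f (x, q) = vector_derivative (\<lambda>t. f (x, q + t *\<^sub>R w)) (at 0)"
  using assms by (simp add: partial_deriv_def dom4_iff)

text \<open>The two functions of \<open>t\<close> that are differentiated coincide, so the equality
  holds whether or not they have a derivative.\<close>

lemma partial_deriv_independent_u:
  assumes "\<not> depends_on (dom4 a b) dir_u f" "x \<in> {a..b}"
  shows "partial_deriv (dom4 a b) (0, w) f (x, y, u, v) = partial_deriv (dom4 a b) (0, w) f (x, y, u', v)"
proof -
  have "f (x, (y, u, v) + t *\<^sub>R w) = f (x, (y, u', v) + t *\<^sub>R w)" for t
    using independent_u[OF assms] by (cases w) simp
  then show ?thesis by (simp only: partial_deriv_dom4[OF assms(2)])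
qed

lemma partial_deriv_independent_v:
  assumes "\<not> depends_on (dom4 a b) dir_v f" "x \<in> {a..b}"
  shows "partial_deriv (dom4 a b) (0, w) f (x, y, u, v) = partial_deriv (dom4 a b) (0, w) f (x, y, u, v')"
proof -
  have "f (x, (y, u, v) + t *\<^sub>R w) = f (x, (y, u, v') + t *\<^sub>R w)" for t
    using independent_v[OF assms] by (cases w) simp
  then show ?thesis by (simp only: partial_deriv_dom4[OF assms(2)])
qed

lemma partial_deriv_u_eq_0:
  assumes "\<not> depends_on (dom4 a b) dir_u f" "x \<in> {a..b}"
  shows "partial_deriv (dom4 a b) dir_u f (x, y, u, v) = 0"
proof -
  have "(\<lambda>t. f (x, (y, u, v) + t *\<^sub>R (0, 1, 0))) = (\<lambda>t. f (x, y, u, v))"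
    using independent_u[OF assms, of y _ v u] by auto
  then show ?thesis by (simp add: dir_u_def partial_deriv_dom4[OF assms(2)])
qed

lemma partial_deriv_v_eq_0:
  assumes "\<not> depends_on (dom4 a b) dir_v f" "x \<in> {a..b}"
  shows "partial_deriv (dom4 a b) dir_v f (x, y, u, v) = 0"
proof -
  have "(\<lambda>t. f (x, (y, u, v) + t *\<^sub>R (0, 0, 1))) = (\<lambda>t. f (x, y, u, v))"
    using independent_v[OF assms, of y u _ v] by auto
  then show ?thesis by (simp add: dir_v_def partial_deriv_dom4[OF assms(2)])
qed

section \<open>Variations within the admissible class\<close>

text \<open>Both functions are handled uniformly as \<open>f \<in> {L, g}\<close>, since the
  presence of a fractional derivative is a property of the pair.\<close>

locale isoperimetric =
  fixes a b \<alpha> \<beta> :: real and L g :: "pt \<Rightarrow> real"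
  assumes ab: "a < b" and \<alpha>: "0 < \<alpha>" "\<alpha> < 1" and \<beta>: "0 < \<beta>" "\<beta> < 1"
    and C1: "f \<in> {L, g} \<Longrightarrow> C1_partials (dom4 a b) f"
begin

text \<open>An absent derivative may be junk, e.g. discontinuous, so its slot is set to 0.\<close>

definition slots :: "(real \<Rightarrow> real) \<Rightarrow> real \<Rightarrow> real \<times> real \<times> real" where
  "slots z x = (z x, if left_present a b L g then RL_left a b \<alpha> z x else 0,
     if right_present a b L g then RL_right a b \<beta> z x else 0)"

text \<open>A slot is set to 0 only if neither function depends on it, so values and partial
  derivatives are unaffected. This trades \<open>along\<close> for a curve that is continuous for
  admissible functions.\<close>

lemma slots_along:
  assumes f: "f \<in> {L, g}" and x: "x \<in> {a..b}"
  shows "f (along a b \<alpha> \<beta> z x) = f (x, slots z x)"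
    and "partial_deriv (dom4 a b) (0, w) f (along a b \<alpha> \<beta> z x) = partial_deriv (dom4 a b) (0, w) f (x, slots z x)"
proof -
  have u: "\<not> left_present a b L g \<Longrightarrow> \<not> depends_on (dom4 a b) dir_u f"
    and v: "\<not> right_present a b L g \<Longrightarrow> \<not> depends_on (dom4 a b) dir_v f"
    using f by (auto simp: left_present_def right_present_def)
  show "f (along a b \<alpha> \<beta> z x) = f (x, slots z x)"
    unfolding along_def slots_def
    using independent_u[OF u x] independent_v[OF v x] by (smt (verit))
  show "partial_deriv (dom4 a b) (0, w) f (along a b \<alpha> \<beta> z x) = partial_deriv (dom4 a b) (0, w) f (x, slots z x)"
    unfolding along_def slots_def
    using partial_deriv_independent_u[OF u x] partial_deriv_independent_v[OF v x] by (smt (verit))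
qed

lemma functional_slots:
  assumes "f \<in> {L, g}"
  shows "functional a b \<alpha> \<beta> f z = integral {a..b} (\<lambda>x. f (x, slots z x))"
  unfolding functional_def by (rule integral_cong) (rule slots_along(1)[OF assms])

lemma slots_continuous: "z \<in> admissible a b \<alpha> \<beta> L g \<Longrightarrow> continuous_on {a..b} (slots z)"
  unfolding slots_def
  by (cases "left_present a b L g"; cases "right_present a b L g")
    (auto simp: admissible_def has_cont_RL_left_def has_cont_RL_right_def intro!: continuous_on_Pair)

lemma C1_test_admissible: "C1_test a b \<eta> \<eta>' \<Longrightarrow> \<eta> \<in> admissible a b \<alpha> \<beta> L g"
  using RL_left_test(1)[OF ab \<alpha>] RL_right_test[OF ab \<beta>] C1_test_continuous
  by (auto simp: admissible_def)

lemma admissible_linear: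
  assumes "z \<in> admissible a b \<alpha> \<beta> L g" "h \<in> admissible a b \<alpha> \<beta> L g"
  shows "(\<lambda>x. z x + r * h x) \<in> admissible a b \<alpha> \<beta> L g"
    and "x \<in> {a..b} \<Longrightarrow> slots (\<lambda>x. z x + r * h x) x = slots z x + r *\<^sub>R slots h x"
proof -
  have c: "continuous_on {a..b} z" "continuous_on {a..b} h"
    using assms by (auto simp: admissible_def)
  note lin = RL_left_linear[OF ab \<alpha> c _ _ refl, where r = r] RL_right_linear[OF ab \<beta> c _ _ refl, where r = r]
  show "(\<lambda>x. z x + r * h x) \<in> admissible a b \<alpha> \<beta> L g"
    using assms lin(1,3) by (auto simp: admissible_def intro!: continuous_intros)
  show "slots (\<lambda>x. z x + r * h x) x = slots z x + r *\<^sub>R slots h x" if "x \<in> {a..b}"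
    using assms lin(2,4) that by (auto simp: admissible_def slots_def)
qed

lemma partial_deriv_along_continuous:
  assumes "f \<in> {L, g}" "y \<in> admissible a b \<alpha> \<beta> L g" "(0, w) \<in> (Basis :: pt set)"
  shows "continuous_on {a..b} (\<lambda>x. partial_deriv (dom4 a b) (0, w) f (along a b \<alpha> \<beta> y x))"
proof -
  have "continuous_on {a..b} (\<lambda>x. partial_deriv (dom4 a b) (0, w) f (x, slots y x))"
    by (rule continuous_on_compose2[OF partial_deriv_continuous[OF C1[OF assms(1)] assms(3)]])
      (auto simp: dom4_iff intro!: continuous_intros slots_continuous assms(2))
  then show ?thesis
    by (subst continuous_on_cong[OF refl slots_along(2)[OF assms(1)]])
qed

lemmas dirs_continuous =
  partial_deriv_along_continuous[OF _ _ Basis_pt_members(2)[unfolded dir_y_def], folded dir_y_def]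
  partial_deriv_along_continuous[OF _ _ Basis_pt_members(3)[unfolded dir_u_def], folded dir_u_def]
  partial_deriv_along_continuous[OF _ _ Basis_pt_members(4)[unfolded dir_v_def], folded dir_v_def]

lemma euler_lagrange_continuous:
  assumes "f \<in> {L, g}" "y \<in> admissible a b \<alpha> \<beta> L g" "regular_along a b \<alpha> \<beta> f y"
  shows "continuous_on {a..b} (euler_lagrange a b \<alpha> \<beta> f y)"
  unfolding euler_lagrange_def
  using assms(3) dirs_continuous(1)[OF assms(1,2)]
  by (intro continuous_on_add) (auto simp: regular_along_def has_cont_RL_left_def has_cont_RL_right_def)

text \<open>Integration by parts in the \<open>u\<close> and \<open>v\<close> terms frees \<eta> of
  fractional derivatives, which is the form the fundamental lemma requires.\<close>

lemma first_variation_test: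
  assumes f: "f \<in> {L, g}" and y: "y \<in> admissible a b \<alpha> \<beta> L g" and reg: "regular_along a b \<alpha> \<beta> f y"
    and test: "C1_test a b \<eta> \<eta>'"
  shows "integral {a..b} (\<lambda>x. blinfun_apply (grad_yuv a b f (x, slots y x)) (slots \<eta> x)) =
    integral {a..b} (\<lambda>x. euler_lagrange a b \<alpha> \<beta> f y x * \<eta> x)"
proof -
  let ?p = "\<lambda>e x. partial_deriv (dom4 a b) e f (along a b \<alpha> \<beta> y x)"
  note cont = dirs_continuous[OF f y]
  have RL: "continuous_on {a..b} (RL_right a b \<alpha> (?p dir_u))" "continuous_on {a..b} (RL_left a b \<beta> (?p dir_v))"
    "continuous_on {a..b} (RL_left a b \<alpha> \<eta>)" "continuous_on {a..b} (RL_right a b \<beta> \<eta>)"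
    using reg RL_left_test(1)[OF ab \<alpha> test] RL_right_test[OF ab \<beta> test]
    by (auto simp: regular_along_def has_cont_RL_left_def has_cont_RL_right_def)
  note c = cont RL C1_test_continuous[OF test]
  \<comment> \<open>For an absent derivative \<open>slots \<eta>\<close> contributes 0 where the
    integrand below has a fractional derivative of \<eta>; the vanishing coefficient makes both
    terms 0.\<close>
  have u: "?p dir_u x = 0" if "\<not> left_present a b L g" "x \<in> {a..b}" for x
    using that f partial_deriv_u_eq_0 by (auto simp: left_present_def along_def)
  have v: "?p dir_v x = 0" if "\<not> right_present a b L g" "x \<in> {a..b}" for x
    using that f partial_deriv_v_eq_0 by (auto simp: right_present_def along_def)
  have "integral {a..b} (\<lambda>x. blinfun_apply (grad_yuv a b f (x, slots y x)) (slots \<eta> x)) =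
      integral {a..b} (\<lambda>x. ?p dir_y x * \<eta> x + ?p dir_u x * RL_left a b \<alpha> \<eta> x + ?p dir_v x * RL_right a b \<beta> \<eta> x)"
  proof (rule integral_cong)
    fix x assume x: "x \<in> {a..b}"
    have "blinfun_apply (grad_yuv a b f (x, slots y x)) (slots \<eta> x) =
        ?p dir_y x * fst (slots \<eta> x) + ?p dir_u x * fst (snd (slots \<eta> x)) + ?p dir_v x * snd (snd (slots \<eta> x))"
      unfolding dir_y_def dir_u_def dir_v_def slots_along(2)[OF f x]
      unfolding dir_y_def[symmetric] dir_u_def[symmetric] dir_v_def[symmetric]
      by (simp add: grad_yuv_apply[symmetric])
    then show "blinfun_apply (grad_yuv a b f (x, slots y x)) (slots \<eta> x) =
        ?p dir_y x * \<eta> x + ?p dir_u x * RL_left a b \<alpha> \<eta> x + ?p dir_v x * RL_right a b \<beta> \<eta> x"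
      using u[OF _ x] v[OF _ x] by (auto simp: slots_def)
  qed
  also have "\<dots> = integral {a..b} (\<lambda>x. ?p dir_y x * \<eta> x) +
      integral {a..b} (\<lambda>x. ?p dir_u x * RL_left a b \<alpha> \<eta> x) + integral {a..b} (\<lambda>x. ?p dir_v x * RL_right a b \<beta> \<eta> x)"
    by (subst integral_add integral_add; (intro integrable_continuous_real continuous_intros c)?)+ simp
  also have "\<dots> = integral {a..b} (\<lambda>x. ?p dir_y x * \<eta> x) +
      integral {a..b} (\<lambda>x. RL_right a b \<alpha> (?p dir_u) x * \<eta> x) + integral {a..b} (\<lambda>x. RL_left a b \<beta> (?p dir_v) x * \<eta> x)"
    using RL_left_by_parts[OF ab \<alpha> test cont(2)] RL_right_by_parts[OF ab \<beta> test cont(3)] reg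
    by (simp add: regular_along_def)
  also have "\<dots> = integral {a..b} (\<lambda>x. euler_lagrange a b \<alpha> \<beta> f y x * \<eta> x)"
    unfolding euler_lagrange_def distrib_right
    by (subst integral_add integral_add; (intro integrable_continuous_real continuous_intros c)?)+ simp
  finally show ?thesis .
qed

text \<open>Partial derivatives are linear in the integrand, and regularity of \<open>L\<close> and
  \<open>g\<close> separately lets the fractional derivatives of the combination be split.\<close>

lemma euler_lagrange_diff:
  assumes y: "y \<in> admissible a b \<alpha> \<beta> L g"
    and reg: "regular_along a b \<alpha> \<beta> L y" "regular_along a b \<alpha> \<beta> g y" and x: "x \<in> {a..b}"
  shows "euler_lagrange a b \<alpha> \<beta> (\<lambda>p. L p - lam * g p) y x =
    euler_lagrange a b \<alpha> \<beta> L y x - lam * euler_lagrange a b \<alpha> \<beta> g y x"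
proof -
  let ?p = "\<lambda>e f x. partial_deriv (dom4 a b) e f (along a b \<alpha> \<beta> y x)"
  \<comment> \<open>Written with \<open>+ (- lam)\<close> to match the shape
    \<open>f x + r * h x\<close> of the linearity lemmas.\<close>
  have pd: "?p e (\<lambda>p. L p - lam * g p) s = ?p e L s + (- lam) * ?p e g s"
    if "s \<in> {a..b}" "e \<in> {dir_y, dir_u, dir_v}" for e s
  proof -
    obtain w where w: "e = (0, w)" using \<open>e \<in> _\<close> by (auto simp: dir_y_def dir_u_def dir_v_def)
    have e: "e \<in> Basis" using that(2) Basis_pt_members by auto
    have D: "((\<lambda>t. f (along a b \<alpha> \<beta> y s + t *\<^sub>R e)) has_real_derivative ?p e f s) (at 0)"
      if "f \<in> {L, g}" for f
      using partial_deriv_works[OF C1[OF that] e, of "along a b \<alpha> \<beta> y s"] \<open>s \<in> {a..b}\<close>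
      by (simp add: along_def dom4_iff w plus_prod_def)
    have "((\<lambda>t. L (along a b \<alpha> \<beta> y s + t *\<^sub>R e) - lam * g (along a b \<alpha> \<beta> y s + t *\<^sub>R e))
        has_real_derivative ?p e L s - lam * ?p e g s) (at 0)"
      by (intro DERIV_diff DERIV_cmult D) auto
    moreover have "{t. along a b \<alpha> \<beta> y s + t *\<^sub>R e \<in> dom4 a b} = UNIV"
      using \<open>s \<in> {a..b}\<close> by (simp add: along_def dom4_iff w plus_prod_def)
    ultimately show ?thesis
      by (simp add: partial_deriv_def has_real_derivative_iff_has_vector_derivative vector_derivative_at)
  qed
  have L: "L \<in> {L, g}" and g: "g \<in> {L, g}" by auto
  have "RL_right a b \<alpha> (?p dir_u (\<lambda>p. L p - lam * g p)) x =
      RL_right a b \<alpha> (?p dir_u L) x + (- lam) * RL_right a b \<alpha> (?p dir_u g) x"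
    by (rule RL_right_linear(2)[OF ab \<alpha> dirs_continuous(2)[OF L y] dirs_continuous(2)[OF g y]])
      (use reg x pd in \<open>auto simp: regular_along_def\<close>)
  moreover have "RL_left a b \<beta> (?p dir_v (\<lambda>p. L p - lam * g p)) x =
      RL_left a b \<beta> (?p dir_v L) x + (- lam) * RL_left a b \<beta> (?p dir_v g) x"
    by (rule RL_left_linear(2)[OF ab \<beta> dirs_continuous(3)[OF L y] dirs_continuous(3)[OF g y]])
      (use reg x pd in \<open>auto simp: regular_along_def\<close>)
  ultimately show ?thesis
    using pd[OF x, of dir_y] by (simp add: euler_lagrange_def algebra_simps)
qed

lemma variations_proportional:
  assumes N: "norm_on a b (admissible a b \<alpha> \<beta> L g) N"
    and extr: "local_min_at (isoperimetric_set a b \<alpha> \<beta> L g ya yb l) N (functional a b \<alpha> \<beta> L) y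
       \<or> local_max_at (isoperimetric_set a b \<alpha> \<beta> L g ya yb l) N (functional a b \<alpha> \<beta> L) y"
    and test: "C1_test a b \<eta>1 \<eta>1'" "C1_test a b \<eta>2 \<eta>2'"
  defines "V \<equiv> \<lambda>f \<eta>. integral {a..b} (\<lambda>x. blinfun_apply (grad_yuv a b f (x, slots y x)) (slots \<eta> x))"
  shows "V L \<eta>1 * V g \<eta>2 = V L \<eta>2 * V g \<eta>1"
proof (rule ccontr)
  assume det: "V L \<eta>1 * V g \<eta>2 \<noteq> V L \<eta>2 * V g \<eta>1"
  let ?A = "admissible a b \<alpha> \<beta> L g"
  let ?K = "isoperimetric_set a b \<alpha> \<beta> L g ya yb l"
  have yK: "y \<in> ?K" using extr by (auto simp: local_min_at_def local_max_at_def)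
  then have y: "y \<in> ?A" by (simp add: isoperimetric_set_def)
  note \<eta> = test[THEN C1_test_admissible]
  \<comment> \<open>Bracketed as two successive perturbations, so that
    \<open>admissible_linear\<close> applies twice.\<close>
  define Y where "Y s = (\<lambda>x. (y x + fst s * \<eta>1 x) + snd s * \<eta>2 x)" for s :: "real \<times> real"
  define \<Phi> where "\<Phi> f s = integral {a..b} (\<lambda>x. f (x, slots y x + fst s *\<^sub>R slots \<eta>1 x + snd s *\<^sub>R slots \<eta>2 x))"
    for f :: "pt \<Rightarrow> real" and s :: "real \<times> real"
  have YA: "Y s \<in> ?A" for s
    unfolding Y_def by (intro admissible_linear(1) y \<eta>)
  have sY: "slots (Y s) x = slots y x + fst s *\<^sub>R slots \<eta>1 x + snd s *\<^sub>R slots \<eta>2 x" if "x \<in> {a..b}" for s x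
    unfolding Y_def using that by (simp add: admissible_linear y \<eta>)
  have \<Phi>: "functional a b \<alpha> \<beta> f (Y s) = \<Phi> f s" if "f \<in> {L, g}" for f s
    unfolding functional_slots[OF that] \<Phi>_def by (rule integral_cong) (simp add: sY)
  have Y0: "Y 0 = y" by (simp add: Y_def)
  have fv: "continuous_on UNIV (\<Phi> f)"
    "(\<Phi> f has_derivative (\<lambda>s. fst s * V f \<eta>1 + snd s * V f \<eta>2)) (at 0)" if "f \<in> {L, g}" for f
    using first_variation[OF C1[OF that] slots_continuous[OF y] slots_continuous[OF \<eta>(1)] slots_continuous[OF \<eta>(2)]]
    unfolding \<Phi>_def[abs_def] V_def by simp_all
  note N' = N[unfolded norm_on_def]
  have nonneg: "0 \<le> N f" if "f \<in> ?A" for f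
    using bspec[OF conjunct1[OF N'] that] by (rule conjunct1)
  have hom: "N (\<lambda>x. r * f x) = \<bar>r\<bar> * N f" if "f \<in> ?A" for f r
    using bspec[OF conjunct1[OF conjunct2[OF N']] that] by (rule spec)
  have tri: "N (\<lambda>x. f x + h x) \<le> N f + N h" if "f \<in> ?A" "h \<in> ?A" for f h
    by (rule bspec[OF bspec[OF conjunct2[OF conjunct2[OF N']] that(1)] that(2)])
  \<comment> \<open>Homogeneity and the triangle inequality bound the distance linearly in
    \<open>s\<close>, whatever the norm.\<close>
  have small: "N (\<lambda>x. y x - Y s x) \<le> norm s * (N \<eta>1 + N \<eta>2)" for s
  proof -
    \<comment> \<open>\<open>admissible_linear\<close> produces \<open>z + r * h\<close>; a multiple
      is obtained as \<open>\<eta> + (r - 1) * \<eta>\<close>.\<close>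
    have sc: "(\<lambda>x. r * \<eta> x) \<in> ?A" if "\<eta> \<in> ?A" for r \<eta>
      using admissible_linear(1)[OF that that, of "r - 1"] by (simp add: algebra_simps)
    have "N (\<lambda>x. y x - Y s x) = N (\<lambda>x. (- fst s) * \<eta>1 x + (- snd s) * \<eta>2 x)"
      by (simp add: Y_def algebra_simps)
    also have "\<dots> \<le> N (\<lambda>x. (- fst s) * \<eta>1 x) + N (\<lambda>x. (- snd s) * \<eta>2 x)"
      by (rule tri[OF sc[OF \<eta>(1), of "- fst s"] sc[OF \<eta>(2), of "- snd s"]])
    also have "\<dots> = \<bar>fst s\<bar> * N \<eta>1 + \<bar>snd s\<bar> * N \<eta>2"
      by (simp only: hom[OF \<eta>(1)] hom[OF \<eta>(2)] abs_minus_cancel)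
    also have "\<dots> \<le> norm s * N \<eta>1 + norm s * N \<eta>2"
      using norm_fst_le[of "fst s" "snd s"] norm_snd_le[of "snd s" "fst s"]
      by (intro add_mono mult_right_mono nonneg \<eta>) simp_all
    finally show ?thesis by (simp add: distrib_left)
  qed
  have N0: "0 \<le> N \<eta>1 + N \<eta>2" using nonneg[OF \<eta>(1)] nonneg[OF \<eta>(2)] by simp
  have YK: "Y s \<in> ?K" if "\<Phi> g s = \<Phi> g 0" for s
  proof -
    have yK': "y a = ya" "y b = yb" "functional a b \<alpha> \<beta> g y = l"
      using yK by (simp_all add: isoperimetric_set_def)
    have "\<eta>1 a = 0" "\<eta>1 b = 0" "\<eta>2 a = 0" "\<eta>2 b = 0"
      using test by (simp_all add: C1_test_def)
    then have "Y s a = ya" "Y s b = yb" using yK' by (simp_all add: Y_def)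
    moreover have "functional a b \<alpha> \<beta> g (Y s) = functional a b \<alpha> \<beta> g (Y 0)"
      using that by (simp add: \<Phi>)
    then have "functional a b \<alpha> \<beta> g (Y s) = l" unfolding Y0 using yK'(3) by simp
    ultimately show ?thesis using YA by (simp add: isoperimetric_set_def)
  qed
  have Lg: "L \<in> {L, g}" "g \<in> {L, g}" by auto
  note two = lagrange_two_parameters[OF fv(1)[OF Lg(1)] fv(1)[OF Lg(2)] fv(2)[OF Lg(1)] fv(2)[OF Lg(2)] det]
  \<comment> \<open>The \<open>+ 1\<close> keeps the denominator positive even if both norms are
    0.\<close>
  have near: "N (\<lambda>x. y x - Y s x) < \<delta>" if "\<delta> > 0" "norm s < \<delta> / (N \<eta>1 + N \<eta>2 + 1)" for s \<delta>
  proof -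
    have "norm s * (N \<eta>1 + N \<eta>2) \<le> norm s * (N \<eta>1 + N \<eta>2 + 1)" by (intro mult_left_mono) auto
    also have "\<dots> < \<delta>" using that N0 by (simp add: pos_less_divide_eq)
    finally show ?thesis using small[of s] by linarith
  qed
  have pos: "\<delta> / (N \<eta>1 + N \<eta>2 + 1) > 0" if "\<delta> > 0" for \<delta> using that N0 by simp
  from extr show False
  proof
    assume "local_min_at ?K N (functional a b \<alpha> \<beta> L) y"
    then obtain \<delta> where \<delta>: "\<delta> > 0"
      "\<And>y1. y1 \<in> ?K \<Longrightarrow> N (\<lambda>x. y x - y1 x) < \<delta> \<Longrightarrow> functional a b \<alpha> \<beta> L y \<le> functional a b \<alpha> \<beta> L y1"
      unfolding local_min_at_def by blast
    obtain s where s: "norm s < \<delta> / (N \<eta>1 + N \<eta>2 + 1)" "\<Phi> g s = \<Phi> g 0" "\<Phi> L s < \<Phi> L 0"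
      using two(1)[OF pos[OF \<delta>(1)]] by blast
    from \<delta>(2)[OF YK[OF s(2)] near[OF \<delta>(1) s(1)]] s(3) show False
      using \<Phi>[OF Lg(1), of s] \<Phi>[OF Lg(1), of 0] unfolding Y0 by linarith
  next
    assume "local_max_at ?K N (functional a b \<alpha> \<beta> L) y"
    then obtain \<delta> where \<delta>: "\<delta> > 0"
      "\<And>y1. y1 \<in> ?K \<Longrightarrow> N (\<lambda>x. y x - y1 x) < \<delta> \<Longrightarrow> functional a b \<alpha> \<beta> L y \<ge> functional a b \<alpha> \<beta> L y1"
      unfolding local_max_at_def by blast
    obtain s where s: "norm s < \<delta> / (N \<eta>1 + N \<eta>2 + 1)" "\<Phi> g s = \<Phi> g 0" "\<Phi> L s > \<Phi> L 0"
      using two(2)[OF pos[OF \<delta>(1)]] by blast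
    from \<delta>(2)[OF YK[OF s(2)] near[OF \<delta>(1) s(1)]] s(3) show False
      using \<Phi>[OF Lg(1), of s] \<Phi>[OF Lg(1), of 0] unfolding Y0 by linarith
  qed
qed

lemma multiplier_rule:
  assumes N: "norm_on a b (admissible a b \<alpha> \<beta> L g) N"
    and extr: "local_min_at (isoperimetric_set a b \<alpha> \<beta> L g ya yb l) N (functional a b \<alpha> \<beta> L) y
       \<or> local_max_at (isoperimetric_set a b \<alpha> \<beta> L g ya yb l) N (functional a b \<alpha> \<beta> L) y"
    and reg: "regular_along a b \<alpha> \<beta> L y" "regular_along a b \<alpha> \<beta> g y"
    and "\<not> extremal a b \<alpha> \<beta> g y"
  shows "\<exists>lam. \<forall>x\<in>{a..b}. euler_lagrange a b \<alpha> \<beta> (\<lambda>p. L p - lam * g p) y x = 0"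
proof -
  let ?E = "\<lambda>f. euler_lagrange a b \<alpha> \<beta> f y"
  let ?V = "\<lambda>f \<eta>. integral {a..b} (\<lambda>x. ?E f x * \<eta> x)"
  have y: "y \<in> admissible a b \<alpha> \<beta> L g"
    using extr by (auto simp: local_min_at_def local_max_at_def isoperimetric_set_def)
  have cont: "continuous_on {a..b} (?E L)" "continuous_on {a..b} (?E g)"
    using euler_lagrange_continuous y reg by auto
  obtain x0 where x0: "x0 \<in> {a..b}" "?E g x0 \<noteq> 0"
    using assms(5) by (auto simp: extremal_def)
  \<comment> \<open>Contraposition of the fundamental lemma. Fixing \<eta>2 before \<eta> makes
    \<open>lam\<close> the same for every \<eta>.\<close>
  obtain \<eta>2 \<eta>2' where \<eta>2: "C1_test a b \<eta>2 \<eta>2'" "?V g \<eta>2 \<noteq> 0"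
    using fundamental_lemma_C1_test[OF ab cont(2) _ x0(1)] x0(2) by blast
  define lam where "lam = ?V L \<eta>2 / ?V g \<eta>2"
  have "?E L x - lam * ?E g x = 0" if "x \<in> {a..b}" for x
  proof (rule fundamental_lemma_C1_test[OF ab _ _ that])
    show "continuous_on {a..b} (\<lambda>x. ?E L x - lam * ?E g x)"
      by (intro continuous_intros cont)
    fix \<eta> \<eta>' assume \<eta>: "C1_test a b \<eta> \<eta>'"
    have "?V L \<eta> * ?V g \<eta>2 = ?V L \<eta>2 * ?V g \<eta>"
      using variations_proportional[OF N extr \<eta> \<eta>2(1)] first_variation_test[OF _ y _ \<eta>]
        first_variation_test[OF _ y _ \<eta>2(1)] reg by simp
    then have *: "?V L \<eta> = lam * ?V g \<eta>" using \<eta>2(2) by (simp add: lam_def field_simps)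
    have "integral {a..b} (\<lambda>x. (?E L x - lam * ?E g x) * \<eta> x) =
        integral {a..b} (\<lambda>x. ?E L x * \<eta> x - lam * (?E g x * \<eta> x))"
      by (simp add: algebra_simps)
    also have "\<dots> = ?V L \<eta> - integral {a..b} (\<lambda>x. lam * (?E g x * \<eta> x))"
      by (intro integral_diff integrable_continuous_real continuous_intros cont C1_test_continuous[OF \<eta>])
    also have "\<dots> = 0" using * by simp
    finally show "integral {a..b} (\<lambda>x. (?E L x - lam * ?E g x) * \<eta> x) = 0" .
  qed
  then show ?thesis using euler_lagrange_diff[OF y reg] by auto
qed

end

theorem theorem6:
  fixes a b \<alpha> \<beta> l ya yb :: real
    and L g :: "real \<times> real \<times> real \<times> real \<Rightarrow> real"
    and N :: "(real \<Rightarrow> real) \<Rightarrow> real"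
    and y :: "real \<Rightarrow> real"
  assumes "a < b"
    and "0 < \<alpha>" "\<alpha> < 1" "0 < \<beta>" "\<beta> < 1"
    and "C2_partials (dom4 a b) L"
    and "C2_partials (dom4 a b) g"
    and "left_present a b L g \<Longrightarrow> ya = 0"
    and "right_present a b L g \<Longrightarrow> yb = 0"
    and "norm_on a b (admissible a b \<alpha> \<beta> L g) N"
    and "local_min_at (isoperimetric_set a b \<alpha> \<beta> L g ya yb l) N (functional a b \<alpha> \<beta> L) y
       \<or> local_max_at (isoperimetric_set a b \<alpha> \<beta> L g ya yb l) N (functional a b \<alpha> \<beta> L) y"
    and "regular_along a b \<alpha> \<beta> L y"
    and "regular_along a b \<alpha> \<beta> g y"
    and "\<not> extremal a b \<alpha> \<beta> g y"
  shows "\<exists>lam::real. \<forall>x\<in>{a..b}. euler_lagrange a b \<alpha> \<beta> (\<lambda>p. L p - lam * g p) y x = 0"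
proof -
  interpret isoperimetric a b \<alpha> \<beta> L g
    by unfold_locales (use assms in \<open>auto simp: C2_partials_def\<close>)
  show ?thesis by (rule multiplier_rule) (use assms in auto)
qed

end
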